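(* Suppose that the probability distribution $P$ of $\mathbf X=\{X_1,\dots,X_p\}$ is fixed and faithful to a DAG $\mathcal G^*$, that $\mathcal D_n$ is data containing $n$ i.i.d. samples from $P$, and that $\phi$ is a score satisfying local consistency. Let $\hat{\mathcal G}_n$ be the output of the hybrid greedy initialization (HGI) algorithm (described in the context) with inputs $\mathcal G_0$, $\mathcal D_n$ and $\mathbf U$. If $\mathcal G_0$ is the skeleton of $\mathcal G^*$ and $\mathbf U$ is the set of v-structures of $\mathcal G^*$, then $\hat{\mathcal G}_n$ is in the same Markov equivalence class as $\mathcal G^*$ with probability approaching one as $n\to\infty$.
   Context: **Graphs.** $\mathbf V=\{1,\dots,p\}$, nodes $i$ are identified with variables $X_i$. An undirected edge is $i-j$, a directed edge $i\to j$. $\boldsymbol\Pi_j^{\mathcal G}$ denotes the set of parents of $X_j$ in $\mathcal G$. A v-structure $(i,k,j)$ is a triplet $i\to k\leftarrow j$ with $i,j$ not adjacent. The skeleton of a graph is obtained by replacing each edge by an undirected one. Two DAGs are Markov equivalent if they have the same d-separation statements. **Faithfulness.** $P$ and a DAG $\mathcal G$ are faithful to each other if for all disjoint $\mathbf A,\mathbf B,\mathbf C\subseteq\mathbf X$, d-separation of $\mathbf A,\mathbf B$ by $\mathbf C$ in $\mathcal G$ is equivalent to $\mathbf A\perp\!\!\!\perp\mathbf B\mid\mathbf C$ in $P$. **Local consistency.** A score $\phi(\mathcal G,\mathcal D)$ (higher is better) is locally consistent if for any DAG $\mathcal G$ and any DAG $\mathcal G'$ obtained from $\mathcal G$ by adding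 an edge $X_i\to X_j$, the following hold asymptotically (with probability tending to one as $n\to\infty$): if $X_j\not\perp\!\!\!\perp X_i\mid\boldsymbol\Pi_j^{\mathcal G}$ in $P$ then $\phi(\mathcal G',\mathcal D)>\phi(\mathcal G,\mathcal D)$; and if $X_j\perp\!\!\!\perp X_i\mid\boldsymbol\Pi_j^{\mathcal G}$ in $P$ then $\phi(\mathcal G',\mathcal D)<\phi(\mathcal G,\mathcal D)$. **Node conditions.** For a node $j$ in a partially directed graph $\mathcal G_0$: (a) $j$ is a sink, i.e. it has no edges directed outwards in $\mathcal G_0$; (b) every vertex $k$ connected to $j$ by an undirected edge in $\mathcal G_0$ is adjacent in $\mathcal G_0$ to all the other vertices adjacent to $j$ in $\mathcal G_0$. An orientation $i\to j$ of an undirected edge $i-j$ "satisfies (a) and (b)" if node $j$ does. A complete sink is a node satisfying (a) with no undirected edges incident to it. **HGI algorithm.** Inputs: undirected graph $\mathcal G_0$, data $\mathcal D$, set $\mathbf U$ of v-structures. 1. Initialize $\mathcal G$ as the empty graph on $\mathbf V$. 2. Repeat: among $(i,k,j)\in\mathbf U$ whose orientation $i\to k$, $j\to k$ does not induce a cycle or conflict with any v-structure in $\mathcal G$, orient $i\to k$ and $j\to k$ in both $\mathcal G_0$ and $\mathcal G$ for the one that most improves $\phi(\mathcal G,\mathcal D)$; until no such improvement is possible. 3. Repeat: delete all edges incident to complete sinks in $\mathcal G_0$; then apply the first applicable of the following operations for an undirected edge $i-j$ in $\mathcal G_0$: (i) apply $i\to j$ to $\mathcal G_0$ and $\mathcal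 G$ satisfying (a) and (b) that most improves $\phi(\mathcal G,\mathcal D)$; (ii) delete from $\mathcal G_0$ the edge $i-j$ satisfying (a) and (b) that, if applied as $i\to j$, would most deteriorate $\phi(\mathcal G,\mathcal D)$; (iii) apply $i\to j$ to $\mathcal G_0$ and $\mathcal G$ compelled by Meek's rules R1–R4 (applied to $\mathcal G_0$) that most improves $\phi(\mathcal G,\mathcal D)$; (iv) delete $i-j$ from $\mathcal G_0$ with $i\to j$ compelled by R1–R4 such that, if applied, it would most deteriorate $\phi(\mathcal G,\mathcal D)$; until no such operation is possible. Output the DAG $\mathcal G$. **Meek's rules.** R1: if $i\to j$, $j-k$, and $i,k$ not adjacent, orient $j\to k$. R2: if $i\to j\to k$ and $i-k$, orient $i\to k$. R3: if $i-j$, $i-k$, $i-l$, $k\to j$, $l\to j$, and $k,l$ not adjacent, orient $i\to j$. R4: if $i-j$, $i-k$, $k\to l$, $l\to j$, $i,l$ adjacent, and $k,j$ not adjacent, orient $i\to j$. *)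

theory Defs
  imports "HOL-Probability.Probability"
begin

section \<open>Directed graphs on the vertices 1, ..., p\<close>

text \<open>A directed graph is given by its edge set; the pair \<open>(i, j)\<close> is the edge \<open>i \<rightarrow> j\<close>.
  An undirected edge \<open>i - j\<close> is the set \<open>{i, j}\<close>.\<close>

type_synonym digraph = "(nat \<times> nat) set"
type_synonym ugraph = "nat set set"

definition dag :: "nat \<Rightarrow> digraph \<Rightarrow> bool" where
  "dag p G \<longleftrightarrow> G \<subseteq> {1..p} \<times> {1..p} \<and> acyclic G"

definition parents :: "digraph \<Rightarrow> nat \<Rightarrow> nat set" where
  "parents G j = {i. (i, j) \<in> G}"

definition adjacent :: "digraph \<Rightarrow> nat \<Rightarrow> nat \<Rightarrow> bool" where
  "adjacent G i j \<longleftrightarrow> (i, j) \<in> G \<or> (j, i) \<in> G"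

definition skeleton :: "digraph \<Rightarrow> ugraph" where
  "skeleton G = {{i, j} | i j. (i, j) \<in> G}"

text \<open>Each v-structure occurs in both orders, as \<open>(i, k, j)\<close> and as \<open>(j, k, i)\<close>.\<close>

definition v_structures :: "digraph \<Rightarrow> (nat \<times> nat \<times> nat) set" where
  "v_structures G =
     {(i, k, j). (i, k) \<in> G \<and> (j, k) \<in> G \<and> i \<noteq> j \<and> \<not> adjacent G i j}"

definition dag_path :: "digraph \<Rightarrow> nat list \<Rightarrow> bool" where
  "dag_path G xs \<longleftrightarrow> xs \<noteq> [] \<and> distinct xs
     \<and> (\<forall>m. Suc m < length xs \<longrightarrow> adjacent G (xs ! m) (xs ! Suc m))"

definition collider :: "digraph \<Rightarrow> nat list \<Rightarrow> nat \<Rightarrow> bool" where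
  "collider G xs m \<longleftrightarrow>
     (xs ! (m - 1), xs ! m) \<in> G \<and> (xs ! Suc m, xs ! m) \<in> G"

definition active :: "digraph \<Rightarrow> nat set \<Rightarrow> nat list \<Rightarrow> bool" where
  "active G C xs \<longleftrightarrow> (\<forall>m. 0 < m \<and> Suc m < length xs \<longrightarrow>
     (if collider G xs m then \<exists>d\<in>C. (xs ! m, d) \<in> G\<^sup>* else xs ! m \<notin> C))"

definition d_separated :: "digraph \<Rightarrow> nat set \<Rightarrow> nat set \<Rightarrow> nat set \<Rightarrow> bool" where
  "d_separated G A B C \<longleftrightarrow>
     \<not> (\<exists>xs. dag_path G xs \<and> hd xs \<in> A \<and> last xs \<in> B \<and> active G C xs)"

definition disjoint3 :: "nat \<Rightarrow> nat set \<Rightarrow> nat set \<Rightarrow> nat set \<Rightarrow> bool" where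
  "disjoint3 p A B C \<longleftrightarrow> A \<subseteq> {1..p} \<and> B \<subseteq> {1..p} \<and> C \<subseteq> {1..p}
     \<and> A \<inter> B = {} \<and> A \<inter> C = {} \<and> B \<inter> C = {}"

definition markov_equivalent :: "nat \<Rightarrow> digraph \<Rightarrow> digraph \<Rightarrow> bool" where
  "markov_equivalent p G H \<longleftrightarrow> dag p G \<and> dag p H
     \<and> (\<forall>A B C. disjoint3 p A B C \<longrightarrow> (d_separated G A B C \<longleftrightarrow> d_separated H A B C))"


section \<open>Distributions, conditional independence and scores\<close>

text \<open>The joint distribution \<open>P\<close> of \<open>X\<^sub>1, ..., X\<^sub>p\<close> is a probability measure on the product of
  the value spaces \<open>S 1, ..., S p\<close>, and \<open>X\<^sub>i\<close> is the \<open>i\<close>-th coordinate.  \<open>sigma_of S P A\<close> is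
  the \<open>\<sigma>\<close>-algebra generated by the variables with index in \<open>A\<close>.\<close>

definition sigma_of :: "(nat \<Rightarrow> 'a measure) \<Rightarrow> (nat \<Rightarrow> 'a) measure \<Rightarrow> nat set \<Rightarrow> (nat \<Rightarrow> 'a) measure" where
  "sigma_of S P A = vimage_algebra (space P) (\<lambda>x. restrict x A) (PiM A S)"

lemma subalgebra_sigma_of:
  assumes "sets P = sets (PiM {1..p} S)" "A \<subseteq> {1..p}"
  shows "subalgebra P (sigma_of S P A)"
proof -
  have "(\<lambda>x. restrict x A) \<in> P \<rightarrow>\<^sub>M PiM A S"
    using measurable_restrict_subset[OF assms(2), of S] measurable_cong_sets[OF assms(1) refl]
    by blast
  then show ?thesis
    unfolding subalgebra_def sigma_of_def
    using sets_vimage_algebra2[of "\<lambda>x. restrict x A" "space P" "PiM A S"]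
    by (auto simp: measurable_def Pi_iff)
qed

definition cond_indep ::
  "(nat \<Rightarrow> 'a measure) \<Rightarrow> (nat \<Rightarrow> 'a) measure \<Rightarrow> nat set \<Rightarrow> nat set \<Rightarrow> nat set \<Rightarrow> bool" where
  "cond_indep S P A B C \<longleftrightarrow>
     (\<forall>E \<in> sets (sigma_of S P A). \<forall>F \<in> sets (sigma_of S P B). AE x in P.
        real_cond_exp P (sigma_of S P C) (indicator (E \<inter> F)) x =
        real_cond_exp P (sigma_of S P C) (indicator E) x *
        real_cond_exp P (sigma_of S P C) (indicator F) x)"

definition faithful :: "nat \<Rightarrow> (nat \<Rightarrow> 'a measure) \<Rightarrow> (nat \<Rightarrow> 'a) measure \<Rightarrow> digraph \<Rightarrow> bool" where
  "faithful p S P G \<longleftrightarrow>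
     (\<forall>A B C. disjoint3 p A B C \<longrightarrow> (d_separated G A B C \<longleftrightarrow> cond_indep S P A B C))"

definition iid_samples ::
  "'w measure \<Rightarrow> 'b measure \<Rightarrow> nat \<Rightarrow> ('w \<Rightarrow> 'b list) \<Rightarrow> bool" where
  "iid_samples M P n D \<longleftrightarrow>
     (\<forall>\<omega>\<in>space M. length (D \<omega>) = n)
     \<and> prob_space.indep_vars M (\<lambda>_. P) (\<lambda>k \<omega>. D \<omega> ! k) {..<n}
     \<and> (\<forall>k<n. distr M P (\<lambda>\<omega>. D \<omega> ! k) = P)"

text \<open>``With probability tending to one''.  No measurability is assumed of scores or of the
  tie-breaking in the algorithm below, so an event is required to contain measurable events
  whose probabilities tend to one.  For measurable events this is the usual notion, see
  \<open>whp_iff\<close>.\<close>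

definition whp :: "'w measure \<Rightarrow> (nat \<Rightarrow> 'w \<Rightarrow> bool) \<Rightarrow> bool" where
  "whp M Q \<longleftrightarrow> (\<exists>E. (\<forall>n. E n \<in> sets M \<and> E n \<subseteq> {\<omega> \<in> space M. Q n \<omega>})
     \<and> (\<lambda>n. measure M (E n)) \<longlonglongrightarrow> 1)"

lemma whp_iff:
  assumes "prob_space M" and meas: "\<And>n. {\<omega> \<in> space M. Q n \<omega>} \<in> sets M"
  shows "whp M Q \<longleftrightarrow> (\<lambda>n. measure M {\<omega> \<in> space M. Q n \<omega>}) \<longlonglongrightarrow> 1"
proof
  interpret prob_space M by fact
  assume "whp M Q"
  then obtain E where E: "\<And>n. E n \<in> sets M" "\<And>n. E n \<subseteq> {\<omega> \<in> space M. Q n \<omega>}"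
    and lim: "(\<lambda>n. measure M (E n)) \<longlonglongrightarrow> 1"
    unfolding whp_def by auto
  have "\<And>n. measure M (E n) \<le> measure M {\<omega> \<in> space M. Q n \<omega>}"
    using E(2) meas by (rule finite_measure_mono)
  then show "(\<lambda>n. measure M {\<omega> \<in> space M. Q n \<omega>}) \<longlonglongrightarrow> 1"
    using tendsto_sandwich[OF _ _ lim tendsto_const] by auto
next
  assume "(\<lambda>n. measure M {\<omega> \<in> space M. Q n \<omega>}) \<longlonglongrightarrow> 1"
  with meas show "whp M Q"
    unfolding whp_def by (intro exI[of _ "\<lambda>n. {\<omega> \<in> space M. Q n \<omega>}"]) auto
qed

definition locally_consistent ::
  "nat \<Rightarrow> (nat \<Rightarrow> 'a measure) \<Rightarrow> (nat \<Rightarrow> 'a) measure \<Rightarrow> 'w measure \<Rightarrow>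
   (nat \<Rightarrow> 'w \<Rightarrow> (nat \<Rightarrow> 'a) list) \<Rightarrow> (digraph \<Rightarrow> (nat \<Rightarrow> 'a) list \<Rightarrow> real) \<Rightarrow> bool" where
  "locally_consistent p S P M D \<phi> \<longleftrightarrow>
     (\<forall>G i j. dag p G \<and> (i, j) \<notin> G \<and> dag p (insert (i, j) G) \<longrightarrow>
        (\<not> cond_indep S P {j} {i} (parents G j) \<longrightarrow>
           whp M (\<lambda>n \<omega>. \<phi> (insert (i, j) G) (D n \<omega>) > \<phi> G (D n \<omega>))) \<and>
        (cond_indep S P {j} {i} (parents G j) \<longrightarrow>
           whp M (\<lambda>n \<omega>. \<phi> (insert (i, j) G) (D n \<omega>) < \<phi> G (D n \<omega>))))"


section \<open>Partially directed graphs\<close>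

datatype pdgraph = PDGraph (dir: digraph) (und: ugraph)

definition pd_adjacent :: "pdgraph \<Rightarrow> nat \<Rightarrow> nat \<Rightarrow> bool" where
  "pd_adjacent K i j \<longleftrightarrow> (i, j) \<in> dir K \<or> (j, i) \<in> dir K \<or> {i, j} \<in> und K"

definition orient :: "pdgraph \<Rightarrow> nat \<Rightarrow> nat \<Rightarrow> pdgraph" where
  "orient K i j = PDGraph (insert (i, j) (dir K)) (und K - {{i, j}})"

definition delete_und :: "pdgraph \<Rightarrow> nat \<Rightarrow> nat \<Rightarrow> pdgraph" where
  "delete_und K i j = PDGraph (dir K) (und K - {{i, j}})"

definition sink :: "pdgraph \<Rightarrow> nat \<Rightarrow> bool" where
  "sink K j \<longleftrightarrow> (\<forall>k. (j, k) \<notin> dir K)"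

definition neighbours_joined :: "pdgraph \<Rightarrow> nat \<Rightarrow> bool" where
  "neighbours_joined K j \<longleftrightarrow>
     (\<forall>k l. {k, j} \<in> und K \<and> pd_adjacent K l j \<and> l \<noteq> k \<longrightarrow> pd_adjacent K k l)"

definition complete_sink :: "pdgraph \<Rightarrow> nat \<Rightarrow> bool" where
  "complete_sink K j \<longleftrightarrow> sink K j \<and> (\<forall>k. {k, j} \<notin> und K)"

definition delete_complete_sinks :: "pdgraph \<Rightarrow> pdgraph" where
  "delete_complete_sinks K = PDGraph
     {(i, j) \<in> dir K. \<not> complete_sink K i \<and> \<not> complete_sink K j}
     {e \<in> und K. \<forall>j\<in>e. \<not> complete_sink K j}"

text \<open>The orientation \<open>i \<rightarrow> j\<close> of an undirected edge \<open>i - j\<close> is compelled by one application of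
  Meek's rules R1, R2, R3, R4, in this order.\<close>

definition meek :: "pdgraph \<Rightarrow> nat \<Rightarrow> nat \<Rightarrow> bool" where
  "meek K i j \<longleftrightarrow> {i, j} \<in> und K \<and>
     ((\<exists>h. (h, i) \<in> dir K \<and> h \<noteq> j \<and> \<not> pd_adjacent K h j) \<or>
      (\<exists>h. (i, h) \<in> dir K \<and> (h, j) \<in> dir K) \<or>
      (\<exists>k l. {i, k} \<in> und K \<and> {i, l} \<in> und K \<and> (k, j) \<in> dir K \<and> (l, j) \<in> dir K \<and>
         k \<noteq> l \<and> \<not> pd_adjacent K k l) \<or>
      (\<exists>k l. {i, k} \<in> und K \<and> (k, l) \<in> dir K \<and> (l, j) \<in> dir K \<and> pd_adjacent K i l \<and>
         k \<noteq> j \<and> \<not> pd_adjacent K k j))"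


section \<open>The hybrid greedy initialization algorithm\<close>

text \<open>The state is \<open>(K, G)\<close>, where \<open>K\<close> is the current \<open>G\<^sub>0\<close> and \<open>G\<close> the graph under
  construction.  In this section \<open>f\<close> is the score at the observed data.  Steps are relations, not
  functions, since several candidates may attain the optimal score; all ways of breaking ties
  are allowed.\<close>

type_synonym state = "pdgraph \<times> digraph"

text \<open>An orientation conflicts with a v-structure of \<open>G\<close> if it reverses one of its edges;
  the third components are covered because \<open>v_structures\<close> contains both orders.\<close>

definition vs_conflict :: "digraph \<Rightarrow> nat \<times> nat \<times> nat \<Rightarrow> bool" where
  "vs_conflict G = (\<lambda>(i, k, j). \<exists>b. (k, i, b) \<in> v_structures G \<or> (k, j, b) \<in> v_structures G)"

definition add_vs :: "digraph \<Rightarrow> nat \<times> nat \<times> nat \<Rightarrow> digraph" where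
  "add_vs G = (\<lambda>(i, k, j). G \<union> {(i, k), (j, k)})"

definition vs_candidates :: "(nat \<times> nat \<times> nat) set \<Rightarrow> digraph \<Rightarrow> (nat \<times> nat \<times> nat) set" where
  "vs_candidates U G = {t \<in> U. acyclic (add_vs G t) \<and> \<not> vs_conflict G t}"

inductive vs_step :: "(digraph \<Rightarrow> real) \<Rightarrow> (nat \<times> nat \<times> nat) set \<Rightarrow> state \<Rightarrow> state \<Rightarrow> bool"
  for f U where
  "\<lbrakk>(i, k, j) \<in> vs_candidates U G;
    f (add_vs G (i, k, j)) > f G;
    \<forall>t \<in> vs_candidates U G. f (add_vs G t) \<le> f (add_vs G (i, k, j))\<rbrakk>
   \<Longrightarrow> vs_step f U (K, G) (orient (orient K i k) j k, add_vs G (i, k, j))"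

definition sink_candidates :: "pdgraph \<Rightarrow> (nat \<times> nat) set" where
  "sink_candidates K = {(i, j). {i, j} \<in> und K \<and> sink K j \<and> neighbours_joined K j}"

definition meek_candidates :: "pdgraph \<Rightarrow> (nat \<times> nat) set" where
  "meek_candidates K = {(i, j). meek K i j}"

definition best_improving :: "(digraph \<Rightarrow> real) \<Rightarrow> digraph \<Rightarrow> (nat \<times> nat) set \<Rightarrow> (nat \<times> nat) set" where
  "best_improving f G C =
     {e \<in> C. f (insert e G) > f G \<and> (\<forall>e'\<in>C. f (insert e' G) \<le> f (insert e G))}"

definition worst_deteriorating :: "(digraph \<Rightarrow> real) \<Rightarrow> digraph \<Rightarrow> (nat \<times> nat) set \<Rightarrow> (nat \<times> nat) set" where
  "worst_deteriorating f G C =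
     {e \<in> C. f (insert e G) < f G \<and> (\<forall>e'\<in>C. f (insert e' G) \<ge> f (insert e G))}"

text \<open>One of the operations (i) to (iv); each one requires that no earlier one is applicable.\<close>

inductive operation :: "(digraph \<Rightarrow> real) \<Rightarrow> state \<Rightarrow> state \<Rightarrow> bool" for f where
  op1: "(i, j) \<in> best_improving f G (sink_candidates K)
    \<Longrightarrow> operation f (K, G) (orient K i j, insert (i, j) G)"
| op2: "\<lbrakk>best_improving f G (sink_candidates K) = {};
     (i, j) \<in> worst_deteriorating f G (sink_candidates K)\<rbrakk>
    \<Longrightarrow> operation f (K, G) (delete_und K i j, G)"
| op3: "\<lbrakk>best_improving f G (sink_candidates K) = {};
     worst_deteriorating f G (sink_candidates K) = {};
     (i, j) \<in> best_improving f G (meek_candidates K)\<rbrakk>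
    \<Longrightarrow> operation f (K, G) (orient K i j, insert (i, j) G)"
| op4: "\<lbrakk>best_improving f G (sink_candidates K) = {};
     worst_deteriorating f G (sink_candidates K) = {};
     best_improving f G (meek_candidates K) = {};
     (i, j) \<in> worst_deteriorating f G (meek_candidates K)\<rbrakk>
    \<Longrightarrow> operation f (K, G) (delete_und K i j, G)"

text \<open>Deleting the edges at complete sinks can create new complete sinks.  The deletion is
  repeated until no complete sink has an incident edge, and only then an operation is applied.\<close>

inductive main_step :: "(digraph \<Rightarrow> real) \<Rightarrow> state \<Rightarrow> state \<Rightarrow> bool" for f where
  "delete_complete_sinks K \<noteq> K \<Longrightarrow> main_step f (K, G) (delete_complete_sinks K, G)"
| "\<lbrakk>delete_complete_sinks K = K; operation f (K, G) s\<rbrakk> \<Longrightarrow> main_step f (K, G) s"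

definition runs_to :: "(state \<Rightarrow> state \<Rightarrow> bool) \<Rightarrow> state \<Rightarrow> state \<Rightarrow> bool" where
  "runs_to step s t \<longleftrightarrow> step\<^sup>*\<^sup>* s t \<and> (\<nexists>u. step t u)"

definition hgi_output ::
  "(digraph \<Rightarrow> 'd \<Rightarrow> real) \<Rightarrow> 'd \<Rightarrow> ugraph \<Rightarrow> (nat \<times> nat \<times> nat) set \<Rightarrow> digraph \<Rightarrow> bool" where
  "hgi_output \<phi> d G\<^sub>0 U G \<longleftrightarrow>
     (\<exists>s K. runs_to (vs_step (\<lambda>H. \<phi> H d) U) (PDGraph {} G\<^sub>0, {}) s \<and>
            runs_to (main_step (\<lambda>H. \<phi> H d)) s (K, G))"


text \<open>The algorithm terminates, so that it has an output for all finite inputs.\<close>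

lemma runs_to_exists:
  fixes m :: "state \<Rightarrow> nat"
  assumes "\<And>s t. I s \<Longrightarrow> step s t \<Longrightarrow> I t \<and> m t < m s" and "I s"
  shows "\<exists>t. runs_to step s t \<and> I t"
  using assms(2)
proof (induction "m s" arbitrary: s rule: less_induct)
  case less
  show ?case
  proof (cases "\<exists>t. step s t")
    case True
    then obtain t where t: "step s t" by blast
    with assms(1) less.prems have "I t" "m t < m s" by blast+
    with less.hyps obtain u where "runs_to step t u" "I u" by blast
    with t show ?thesis unfolding runs_to_def by (meson converse_rtranclp_into_rtranclp)
  next
    case False
    with less.prems show ?thesis unfolding runs_to_def by blast
  qed
qed

lemma hgi_output_exists:
  assumes "finite G\<^sub>0" "finite U"
  shows "\<exists>G. hgi_output \<phi> d G\<^sub>0 U G"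
proof -
  define f where "f = (\<lambda>H. \<phi> H d)"
  define fin where "fin = (\<lambda>s::state. finite (dir (fst s)) \<and> finite (und (fst s)))"
  define W where "W = (\<Union>(i, k, j)\<in>U. {(i, k), (j, k)})"
  have W: "finite W" unfolding W_def using assms(2) by auto
  have "fin t \<and> card (W - snd t) < card (W - snd s)" if "fin s" "vs_step f U s t" for s t
    using that(2,1)
  proof cases
    case (1 i k j G K)
    have G: "G \<subseteq> add_vs G (i, k, j)" "add_vs G (i, k, j) - G \<subseteq> W"
      using 1 by (auto simp: add_vs_def W_def vs_candidates_def)
    moreover have "add_vs G (i, k, j) \<noteq> G" using 1 by auto
    ultimately have "W - add_vs G (i, k, j) \<subset> W - G" by blast
    then show ?thesis
      using 1 that(1) W by (auto simp: fin_def orient_def intro!: psubset_card_mono)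
  qed
  from runs_to_exists[of fin "vs_step f U", OF this, of "(PDGraph {} G\<^sub>0, {})"] assms(1)
  obtain s where s: "runs_to (vs_step f U) (PDGraph {} G\<^sub>0, {}) s" "fin s"
    by (auto simp: fin_def)
  define m where "m = (\<lambda>s::state. card (dir (fst s)) + 2 * card (und (fst s)))"
  have orient_less: "fin (orient K i j, H) \<and> m (orient K i j, H) < m (K, G)"
    if "fin (K, G)" "{i, j} \<in> und K" for K G H i j
    using that card_Suc_Diff1[of "und K" "{i, j}"] card_insert_le_m1[of _ "dir K" "(i, j)"]
      card.insert_remove[of "dir K" "(i, j)"] card_Diff1_le[of "dir K" "(i, j)"]
    by (auto simp: fin_def m_def orient_def)
  have delete_less: "fin (delete_und K i j, H) \<and> m (delete_und K i j, H) < m (K, G)"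
    if "fin (K, G)" "{i, j} \<in> und K" for K G H i j
    using that card_Suc_Diff1[of "und K" "{i, j}"] by (auto simp: fin_def m_def delete_und_def)
  have cand: "{i, j} \<in> und K"
    if "(i, j) \<in> best_improving f G C \<or> (i, j) \<in> worst_deteriorating f G C"
      "C = sink_candidates K \<or> C = meek_candidates K" for i j C G K
    using that by (auto simp: best_improving_def worst_deteriorating_def
        sink_candidates_def meek_candidates_def meek_def)
  have op_less: "fin t \<and> m t < m s" if "fin s" "operation f s t" for s t
    using that(2,1) by cases (use orient_less delete_less cand in blast)+
  have prune_less: "fin (delete_complete_sinks K, G) \<and> m (delete_complete_sinks K, G) < m (K, G)"
    if "fin (K, G)" "delete_complete_sinks K \<noteq> K" for K G
  proof -
    let ?K = "delete_complete_sinks K"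
    have sub: "dir ?K \<subseteq> dir K" "und ?K \<subseteq> und K" by (auto simp: delete_complete_sinks_def)
    have ne: "dir ?K \<noteq> dir K \<or> und ?K \<noteq> und K" using that(2) pdgraph.expand by blast
    have f: "finite (dir K)" "finite (und K)" using that(1) by (auto simp: fin_def)
    have "card (dir ?K) \<le> card (dir K)" "card (und ?K) \<le> card (und K)"
      using sub f by (auto intro: card_mono)
    moreover have "card (dir ?K) < card (dir K) \<or> card (und ?K) < card (und K)"
      using sub ne f by (meson psubsetI psubset_card_mono)
    ultimately show ?thesis using sub f by (auto simp: fin_def m_def intro: finite_subset)
  qed
  have "fin t \<and> m t < m s" if "fin s" "main_step f s t" for s t
    using that(2,1) by cases (use op_less prune_less in blast)+
  from runs_to_exists[of fin "main_step f", OF this s(2)]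
  obtain t where "runs_to (main_step f) s t" by blast
  with s(1) show ?thesis unfolding hgi_output_def f_def by (metis surj_pair)
qed

end

theory Submission
  imports Defs
begin

text \<open>With probability tending to one, inserting an edge between vertices that are adjacent in the
  true graph improves the score of every DAG without that edge, since by faithfulness such vertices
  are dependent given any set of other variables.  On this event the algorithm first orients exactly
  the v-structures.  From then on, the edges oriented so far always extend to a DAG with the skeleton
  and the v-structures of the true graph: a vertex satisfying (a) and (b) can be made a sink of such
  an extension, and Meek's rules orient edges as every extension does.  Hence every candidate
  improves the score and nothing is ever wrongly deleted.  While undirected edges remain, a sink of
  the part of the extension that has not been deleted yet supplies a candidate, so that the output
  is the extension itself.

  That equal skeletons and v-structures imply Markov equivalence is reduced, following Chickering,
  to the reversal of a single covered edge, where active walks can be rerouted.\<close>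

section \<open>Markov equivalence of graphs with the same skeleton and v-structures\<close>

text \<open>Reflexive, so \<open>C\<close> itself is included: these are the vertices at which
  \<open>active\<close> lets a path pass a collider.\<close>

definition ancestors :: "digraph \<Rightarrow> nat set \<Rightarrow> nat set" where
  "ancestors G C = {v. \<exists>d\<in>C. (v, d) \<in> G\<^sup>*}"

text \<open>\<open>walk_to G C a d v\<close>: an active walk leads from \<open>a\<close> to \<open>v\<close>, where \<open>d\<close> tells whether its last edge
  has its arrowhead at \<open>v\<close>.  The trivial walk counts as one without arrowhead, which gives the
  right continuations because \<open>a\<close> is never in \<open>C\<close>.\<close>

inductive walk_to :: "digraph \<Rightarrow> nat set \<Rightarrow> nat \<Rightarrow> bool \<Rightarrow> nat \<Rightarrow> bool" for G C a where
  start: "walk_to G C a False a"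
| child: "\<lbrakk>walk_to G C a d v; v \<notin> C; (v, w) \<in> G\<rbrakk> \<Longrightarrow> walk_to G C a True w"
| parent: "\<lbrakk>walk_to G C a False v; v \<notin> C; (w, v) \<in> G\<rbrakk> \<Longrightarrow> walk_to G C a False w"
| collider: "\<lbrakk>walk_to G C a True v; v \<in> ancestors G C; (w, v) \<in> G\<rbrakk> \<Longrightarrow> walk_to G C a False w"

text \<open>The same without repeated vertices; the list contains the vertices in reverse order.\<close>

inductive trail_to :: "digraph \<Rightarrow> nat set \<Rightarrow> nat \<Rightarrow> bool \<Rightarrow> nat list \<Rightarrow> bool" for G C a where
  start: "trail_to G C a False [a]"
| child: "\<lbrakk>trail_to G C a d (v # r); v \<notin> C; (v, w) \<in> G; w \<notin> set (v # r)\<rbrakk>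
    \<Longrightarrow> trail_to G C a True (w # v # r)"
| parent: "\<lbrakk>trail_to G C a False (v # r); v \<notin> C; (w, v) \<in> G; w \<notin> set (v # r)\<rbrakk>
    \<Longrightarrow> trail_to G C a False (w # v # r)"
| collider: "\<lbrakk>trail_to G C a True (v # r); v \<in> ancestors G C; (w, v) \<in> G; w \<notin> set (v # r)\<rbrakk>
    \<Longrightarrow> trail_to G C a False (w # v # r)"

section \<open>Active walks, active paths and d-separation\<close>

lemma acyclic_asym: "acyclic G \<Longrightarrow> (u, v) \<in> G \<Longrightarrow> (v, u) \<notin> G"
  by (meson acyclic_def r_into_trancl' trancl_trans)

lemma acyclic_irrefl: "acyclic G \<Longrightarrow> (u, u) \<notin> G"
  by (meson acyclic_asym)

lemma ancestors_step: "(u, v) \<in> G \<Longrightarrow> v \<in> ancestors G C \<Longrightarrow> u \<in> ancestors G C"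
  unfolding ancestors_def by (auto intro: converse_rtrancl_into_rtrancl)

lemma ancestors_rtrancl: "(u, v) \<in> G\<^sup>* \<Longrightarrow> v \<in> ancestors G C \<Longrightarrow> u \<in> ancestors G C"
  unfolding ancestors_def by (auto intro: rtrancl_trans)

text \<open>The trail is cut at \<open>w\<close>. If it arrived there without arrowhead,
  \<open>w\<close> was a noncollider or the start, and leaving it required \<open>w\<close> to lie
  outside \<open>C\<close>. If it arrived with arrowhead, \<open>w\<close> is either a collider or
  left along an outgoing edge; following the arrows from there leads to the first collider, which is
  in \<open>ancestors G C\<close>, or all the way to the end of the trail.\<close>

lemma trail_to_truncate:
  assumes "trail_to G C a d xs"
  shows "\<forall>w \<in> set (tl xs). \<exists>d' r. trail_to G C a d' (w # r) \<and> (\<not> d' \<longrightarrow> w \<notin> C) \<and>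
    (d' \<longrightarrow> w \<in> ancestors G C \<or> d \<and> (w, hd xs) \<in> G\<^sup>*)"
  using assms
proof induction
  case start
  then show ?case by simp
next
  case (child d v r w)
  show ?case
  proof
    fix u assume u: "u \<in> set (tl (w # v # r))"
    show "\<exists>d' r'. trail_to G C a d' (u # r') \<and> (\<not> d' \<longrightarrow> u \<notin> C) \<and>
      (d' \<longrightarrow> u \<in> ancestors G C \<or> True \<and> (u, hd (w # v # r)) \<in> G\<^sup>*)"
    proof (cases "u = v")
      case True
      with child.hyps show ?thesis by auto
    next
      case False
      with u have "u \<in> set r" by simp
      with child.IH[unfolded list.sel] obtain d' r' where "trail_to G C a d' (u # r')" "\<not> d' \<longrightarrow> u \<notin> C"
        "d' \<longrightarrow> u \<in> ancestors G C \<or> d \<and> (u, v) \<in> G\<^sup>*" by blast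
      with child.hyps(3) show ?thesis by (auto intro: rtrancl_into_rtrancl)
    qed
  qed
next
  case (parent v r w)
  show ?case
  proof
    fix u assume u: "u \<in> set (tl (w # v # r))"
    show "\<exists>d' r'. trail_to G C a d' (u # r') \<and> (\<not> d' \<longrightarrow> u \<notin> C) \<and>
      (d' \<longrightarrow> u \<in> ancestors G C \<or> False \<and> (u, hd (w # v # r)) \<in> G\<^sup>*)"
    proof (cases "u = v")
      case True
      with parent.hyps show ?thesis by blast
    next
      case False
      with u parent.IH show ?thesis by auto
    qed
  qed
next
  case (collider v r w)
  show ?case
  proof
    fix u assume u: "u \<in> set (tl (w # v # r))"
    show "\<exists>d' r'. trail_to G C a d' (u # r') \<and> (\<not> d' \<longrightarrow> u \<notin> C) \<and>
      (d' \<longrightarrow> u \<in> ancestors G C \<or> False \<and> (u, hd (w # v # r)) \<in> G\<^sup>*)"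
    proof (cases "u = v")
      case True
      with collider.hyps show ?thesis by blast
    next
      case False
      with u have "u \<in> set r" by simp
      with collider.IH[unfolded list.sel] obtain d' r' where "trail_to G C a d' (u # r')" "\<not> d' \<longrightarrow> u \<notin> C"
        "d' \<longrightarrow> u \<in> ancestors G C \<or> (u, v) \<in> G\<^sup>*" by blast
      with ancestors_rtrancl[OF _ collider.hyps(2), of u] show ?thesis by blast
    qed
  qed
qed

text \<open>Repeated vertices are removed by cutting the trail at the first visit. The cut may
  change the kind of arrival; the side condition then ensures that every continuation of the walk is
  still open to the trail: a vertex outside \<open>C\<close> can be passed as a noncollider, one in
  \<open>ancestors G C\<close> as a collider.\<close>

lemma walk_to_imp_trail_to:
  assumes "walk_to G C a d v" "a \<notin> C" "acyclic G"
  shows "(\<exists>r. trail_to G C a d (v # r)) \<or>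
    (\<exists>r. trail_to G C a (\<not> d) (v # r)) \<and> (if d then v \<notin> C else v \<in> ancestors G C)"
  using assms(1)
proof induction
  case start
  then show ?case by (blast intro: trail_to.start)
next
  case (child d v w)
  then obtain d' r where P: "trail_to G C a d' (v # r)" by blast
  show ?case
  proof (cases "w \<in> set r")
    case True
    then obtain d'' r' where "trail_to G C a d'' (w # r')" "\<not> d'' \<longrightarrow> w \<notin> C"
      using trail_to_truncate[OF P, unfolded list.sel] by blast
    then show ?thesis by (cases d'') auto
  next
    case False
    with acyclic_irrefl[OF assms(3)] child.hyps(3) have "w \<notin> set (v # r)" by auto
    with P child show ?thesis by (blast intro: trail_to.child)
  qed
next
  case (parent v w)
  then have "\<exists>d' r. trail_to G C a d' (v # r) \<and> (d' \<longrightarrow> v \<in> ancestors G C)" by auto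
  then obtain d' r where P: "trail_to G C a d' (v # r)" "d' \<longrightarrow> v \<in> ancestors G C" by blast
  show ?case
  proof (cases "w \<in> set r")
    case True
    then obtain d'' r' where Q: "trail_to G C a d'' (w # r')"
      "d'' \<longrightarrow> w \<in> ancestors G C \<or> d' \<and> (w, v) \<in> G\<^sup>*"
      using trail_to_truncate[OF P(1), unfolded list.sel] by blast
    \<comment> \<open>In the case where \<open>w\<close> only reaches the end \<open>v\<close> of
      the trail, \<open>v\<close> is itself an ancestor of \<open>C\<close> by the choice of the
      trail to \<open>v\<close>.\<close>
    have "d'' \<longrightarrow> w \<in> ancestors G C"
      using Q(2) P(2) ancestors_rtrancl by blast
    with Q(1) show ?thesis by (cases d'') auto
  next
    case False
    with acyclic_irrefl[OF assms(3)] parent.hyps(3) have w: "w \<notin> set (v # r)" by auto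
    have "trail_to G C a False (w # v # r)"
    proof (cases d')
      case True
      with P w parent.hyps(3) show ?thesis by (simp add: trail_to.collider)
    next
      case False
      with P w parent.hyps(2,3) show ?thesis by (simp add: trail_to.parent)
    qed
    then show ?thesis by blast
  qed
next
  case (collider v w)
  then have "\<exists>d' r. trail_to G C a d' (v # r) \<and> (\<not> d' \<longrightarrow> v \<notin> C)" by auto
  then obtain d' r where P: "trail_to G C a d' (v # r)" "\<not> d' \<longrightarrow> v \<notin> C" by blast
  show ?case
  proof (cases "w \<in> set r")
    case True
    then obtain d'' r' where "trail_to G C a d'' (w # r')"
      using trail_to_truncate[OF P(1), unfolded list.sel] by blast
    with ancestors_step[OF collider.hyps(3,2)] show ?thesis by (cases d'') auto
  next
    case False
    with acyclic_irrefl[OF assms(3)] collider.hyps(3) have w: "w \<notin> set (v # r)" by auto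
    have "trail_to G C a False (w # v # r)"
    proof (cases d')
      case True
      with P w collider.hyps(2,3) show ?thesis by (simp add: trail_to.collider)
    next
      case False
      with P w collider.hyps(3) show ?thesis by (simp add: trail_to.parent)
    qed
    then show ?thesis by blast
  qed
qed

lemma dag_path_snoc:
  assumes "dag_path G (xs @ [v])" "adjacent G v w" "w \<notin> set (xs @ [v])"
  shows "dag_path G (xs @ [v, w])"
  using assms unfolding dag_path_def
  by (auto simp: nth_append nth_Cons' less_Suc_eq)

lemma active_snoc:
  assumes "active G C (xs @ [u, v])"
    and "if (u, v) \<in> G \<and> (w, v) \<in> G then v \<in> ancestors G C else v \<notin> C"
  shows "active G C (xs @ [u, v, w])"
  unfolding active_def
proof (intro allI impI)
  fix m assume m: "0 < m \<and> Suc m < length (xs @ [u, v, w])"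
  show "if collider G (xs @ [u, v, w]) m
    then \<exists>d\<in>C. ((xs @ [u, v, w]) ! m, d) \<in> G\<^sup>* else (xs @ [u, v, w]) ! m \<notin> C"
  \<comment> \<open>This is the index of \<open>v\<close>, the only vertex that becomes interior; at
    smaller indices nothing changes.\<close>
  proof (cases "m = Suc (length xs)")
    case True
    with assms(2) show ?thesis by (auto simp: collider_def nth_append ancestors_def split: if_splits)
  next
    case False
    with m have l: "m \<le> length xs" by simp
    have "(xs @ [u, v, w]) ! i = (xs @ [u, v]) ! i" if "i \<le> Suc (length xs)" for i
      using that by (auto simp: nth_append nth_Cons')
    with l m show ?thesis
      using assms(1)[unfolded active_def, rule_format, of m] by (simp add: collider_def)
  qed
qed

text \<open>The induction carries the last clause because \<open>active_snoc\<close> reads from the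
  last edge what \<open>trail_to\<close> keeps in its flag; acyclicity makes the direction of that
  edge unambiguous.\<close>

lemma trail_to_active:
  assumes "acyclic G" "trail_to G C a d xs"
  shows "dag_path G (rev xs) \<and> active G C (rev xs) \<and> last xs = a \<and>
    (\<forall>v u r. xs = v # u # r \<longrightarrow> (d \<longleftrightarrow> (u, v) \<in> G))"
  using assms(2)
proof induction
  case start
  then show ?case by (simp add: dag_path_def active_def)
next
  case (child d v r w)
  have "dag_path G (rev r @ [v, w])"
    using dag_path_snoc[of G "rev r" v w] child by (auto simp: adjacent_def)
  moreover have "active G C (rev r @ [v, w])"
  proof (cases r)
    case Nil
    then show ?thesis by (simp add: active_def)
  next
    case (Cons u r')
    with child active_snoc[of G C "rev r'" u v w] acyclic_asym[OF assms(1)] show ?thesis by auto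
  qed
  ultimately show ?case using child by auto
next
  case (parent v r w)
  have "dag_path G (rev r @ [v, w])"
    using dag_path_snoc[of G "rev r" v w] parent by (auto simp: adjacent_def)
  moreover have "active G C (rev r @ [v, w])"
  proof (cases r)
    case Nil
    then show ?thesis by (simp add: active_def)
  next
    case (Cons u r')
    with parent active_snoc[of G C "rev r'" u v w] show ?thesis by auto
  qed
  ultimately show ?case using parent acyclic_asym[OF assms(1)] by auto
next
  case (collider v r w)
  have "dag_path G (rev r @ [v, w])"
    using dag_path_snoc[of G "rev r" v w] collider by (auto simp: adjacent_def)
  moreover have "active G C (rev r @ [v, w])"
  proof (cases r)
    case Nil
    then show ?thesis by (simp add: active_def)
  next
    case (Cons u r')
    with collider active_snoc[of G C "rev r'" u v w] show ?thesis by auto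
  qed
  ultimately show ?case using collider acyclic_asym[OF assms(1)] by auto
qed

text \<open>Induction over the prefixes of the path, with the flag recomputed from the last edge. At
  \<open>m = 0\<close> there is no last edge, and the flag is false as in
  \<open>walk_to.start\<close>.\<close>

lemma active_path_imp_walk_to:
  assumes "acyclic G" "dag_path G xs" "active G C xs" "hd xs \<notin> C" "m < length xs"
  shows "walk_to G C (hd xs) (0 < m \<and> (xs ! (m - 1), xs ! m) \<in> G) (xs ! m)"
  using assms(5)
proof (induction m)
  case 0
  then show ?case by (auto simp: hd_conv_nth intro: walk_to.start)
next
  case (Suc m)
  let ?u = "xs ! (m - 1)" and ?v = "xs ! m" and ?w = "xs ! Suc m"
  have IH: "walk_to G C (hd xs) (0 < m \<and> (?u, ?v) \<in> G) ?v" using Suc by simp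
  have adj: "(?v, ?w) \<in> G \<or> (?w, ?v) \<in> G"
    using assms(2) Suc.prems by (auto simp: dag_path_def adjacent_def)
  have act: "if collider G xs m then ?v \<in> ancestors G C else ?v \<notin> C" if "0 < m"
    using assms(3) Suc.prems that by (auto simp: active_def ancestors_def)
  have v0: "?v \<notin> C" if "m = 0" using that assms(4) Suc.prems by (cases xs) auto
  show ?case
  proof (cases "(?v, ?w) \<in> G")
    case True
    with acyclic_asym[OF assms(1)] act v0 have "?v \<notin> C"
      by (cases "m = 0") (auto simp: collider_def)
    with IH True show ?thesis using walk_to.child by fastforce
  next
    case False
    with adj have w: "(?w, ?v) \<in> G" by blast
    show ?thesis
    proof (cases "0 < m \<and> (?u, ?v) \<in> G")
      case True
      with act w have "?v \<in> ancestors G C" by (auto simp: collider_def)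
      with IH w True False show ?thesis using walk_to.collider by fastforce
    next
      case no: False
      with act v0 have "?v \<notin> C" by (cases "m = 0") (auto simp: collider_def)
      have "(0 < m \<and> (?u, ?v) \<in> G) = False" using no by blast
      with IH have "walk_to G C (hd xs) False ?v" by (simp only:)
      from walk_to.parent[OF this \<open>?v \<notin> C\<close> w] False show ?thesis by simp
    qed
  qed
qed

text \<open>Walks may repeat vertices, so they can be rerouted locally without checking that the
  result is still a path.\<close>

lemma d_separated_iff_walk_to:
  assumes "acyclic G" "A \<inter> C = {}"
  shows "d_separated G A B C \<longleftrightarrow> \<not> (\<exists>a\<in>A. \<exists>b\<in>B. \<exists>d. walk_to G C a d b)"
proof -
  have "\<exists>xs. dag_path G xs \<and> hd xs \<in> A \<and> last xs \<in> B \<and> active G C xs"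
    if ab: "a \<in> A" "b \<in> B" and w: "walk_to G C a d b" for a b d
  proof -
    have "a \<notin> C" using ab assms(2) by blast
    then obtain d' r where P: "trail_to G C a d' (b # r)"
      using walk_to_imp_trail_to[OF w _ assms(1)] by blast
    have "hd (rev (b # r)) = last (b # r)" "last (rev (b # r)) = b"
      by (simp_all add: hd_rev last_rev)
    with trail_to_active[OF assms(1) P] ab show ?thesis by metis
  qed
  moreover have "walk_to G C (hd xs) (0 < length xs - 1 \<and>
      (xs ! (length xs - 1 - 1), xs ! (length xs - 1)) \<in> G) (last xs)"
    if "dag_path G xs" "hd xs \<in> A" "active G C xs" for xs
  proof -
    have "xs \<noteq> []" using that(1) by (simp add: dag_path_def)
    moreover have "hd xs \<notin> C" using that(2) assms(2) by blast
    ultimately show ?thesis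
      using active_path_imp_walk_to[OF assms(1) that(1,3), of "length xs - 1"]
      by (simp add: last_conv_nth)
  qed
  ultimately show ?thesis unfolding d_separated_def by blast
qed

subsection \<open>Reversal of covered edges\<close>

definition covered :: "digraph \<Rightarrow> nat \<Rightarrow> nat \<Rightarrow> bool" where
  "covered G x y \<longleftrightarrow> (x, y) \<in> G \<and> parents G y = insert x (parents G x)"

definition reverse :: "digraph \<Rightarrow> nat \<Rightarrow> nat \<Rightarrow> digraph" where
  "reverse G x y = insert (y, x) (G - {(x, y)})"

locale covered_edge =
  fixes G :: digraph and x y :: nat
  assumes acyclic: "acyclic G" and covered: "covered G x y"
begin

abbreviation "H \<equiv> reverse G x y"

lemma edge: "(x, y) \<in> G" and ne: "x \<noteq> y" and not_edge: "(y, x) \<notin> G"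
  using covered acyclic_irrefl[OF acyclic] acyclic_asym[OF acyclic]
  unfolding covered_def by blast+

lemma parents_iff: "(v, y) \<in> G \<longleftrightarrow> v = x \<or> (v, x) \<in> G"
  using covered unfolding covered_def parents_def by auto

text \<open>As \<open>x\<close> and \<open>y\<close> share their other parents, an edge entering the
  pair from outside has a twin entering the other vertex, and both survive the reversal.\<close>

lemma edge_cases:
  assumes "(v, w) \<in> G"
  obtains (reversed) "v = x" "w = y"
    | (into) "v \<noteq> x" "v \<noteq> y" "w = x \<or> w = y" "(v, x) \<in> H" "(v, y) \<in> H"
    | (outof) "v = x \<or> v = y" "w \<noteq> x" "w \<noteq> y" "(v, w) \<in> H"
    | (other) "v \<noteq> x" "v \<noteq> y" "w \<noteq> x" "w \<noteq> y" "(v, w) \<in> H"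
  using assms parents_iff[of v] ne not_edge edge acyclic_irrefl[OF acyclic, of x]
    acyclic_irrefl[OF acyclic, of y] unfolding reverse_def by (cases "v = x"; cases "v = y"; auto)

lemma reversed_edge: "(y, x) \<in> H"
  by (simp add: reverse_def)

text \<open>A cycle through the reversed edge needs a second directed path from \<open>x\<close> to
  \<open>y\<close>. Its last vertex before \<open>y\<close> is a parent of \<open>y\<close> other
  than \<open>x\<close>, hence a parent of \<open>x\<close>, which closes a cycle in
  \<open>G\<close>.\<close>

lemma acyclic_reverse: "acyclic H"
proof -
  have "(x, y) \<notin> (G - {(x, y)})\<^sup>*"
  proof
    assume "(x, y) \<in> (G - {(x, y)})\<^sup>*"
    then obtain v where v: "(x, v) \<in> (G - {(x, y)})\<^sup>*" "(v, y) \<in> G - {(x, y)}"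
      using ne by (metis rtranclE)
    then have "(v, x) \<in> G" using parents_iff by auto
    moreover have "(x, v) \<in> G\<^sup>*" using v(1) rtrancl_mono[of "G - {(x, y)}" G] by blast
    ultimately show False using acyclic by (meson acyclic_def rtrancl_into_trancl1)
  qed
  then show ?thesis
    unfolding reverse_def using acyclic acyclic_insert acyclic_subset[of G "G - {(x, y)}"] by blast
qed

text \<open>A directed path that enters \<open>x\<close> and then uses the reversed edge can go to
  \<open>y\<close> directly, since a parent of \<open>x\<close> is a parent of \<open>y\<close>.
  Only a path starting at \<open>x\<close> has no such shortcut.\<close>

lemma ancestors_reverse:
  assumes "v \<in> ancestors G C"
  shows "v \<in> ancestors H C \<or> v = x \<and> y \<in> ancestors H C"
proof -
  obtain d where d: "d \<in> C" "(v, d) \<in> G\<^sup>*" using assms unfolding ancestors_def by blast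
  from d(2) show ?thesis
  proof (induction rule: converse_rtrancl_induct)
    case base
    then show ?case using d(1) unfolding ancestors_def by blast
  next
    case (step u w)
    from step(1) show ?case
    proof (cases rule: edge_cases)
      case reversed
      with step(3) ne show ?thesis by blast
    next
      case into
      with step(3) ancestors_step show ?thesis by blast
    next
      case outof
      with step(3) ancestors_step show ?thesis by blast
    next
      case other
      with step(3) ancestors_step show ?thesis by blast
    qed
  qed
qed

text \<open>Away from the edge, walks are copied; a walk through \<open>x\<close> or \<open>y\<close> is rerouted, so that \<open>tail_at_x\<close>
  and \<open>sim\<close> only keep what is needed to continue it.\<close>

definition tail_at_x :: "nat set \<Rightarrow> nat \<Rightarrow> bool" where
  "tail_at_x C a \<longleftrightarrow> walk_to H C a False x \<or> walk_to H C a False y \<and> y \<notin> C \<or>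
     walk_to H C a True x \<and> walk_to H C a True y \<and> y \<in> ancestors H C"

definition sim :: "nat set \<Rightarrow> nat \<Rightarrow> bool \<Rightarrow> nat \<Rightarrow> bool" where
  "sim C a d v \<longleftrightarrow>
    (if v = x then if d then walk_to H C a True x \<and> walk_to H C a True y else tail_at_x C a
     else if v = y then
       if d then walk_to H C a True x \<and> walk_to H C a True y \<or> x \<notin> C \<and> tail_at_x C a
       else walk_to H C a False y
     else walk_to H C a d v)"

lemma tail_at_x_child:
  assumes "tail_at_x C a" "x \<notin> C" "(x, w) \<in> H"
  shows "walk_to H C a True w"
proof -
  have "\<exists>d. walk_to H C a d x"
    using assms(1) reversed_edge unfolding tail_at_x_def by (blast intro: walk_to.child)
  with assms(2,3) show ?thesis by (blast intro: walk_to.child)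
qed

lemma tail_at_x_parent:
  assumes "tail_at_x C a" "x \<notin> C" "(w, x) \<in> H" "(w, y) \<in> H"
  shows "walk_to H C a False w"
  using assms unfolding tail_at_x_def by (blast intro: walk_to.parent walk_to.collider)

lemma tail_at_x_child_y:
  assumes "tail_at_x C a" "x \<notin> C" "y \<notin> C" "(y, w) \<in> H"
  shows "walk_to H C a True w"
proof -
  have "\<exists>d. walk_to H C a d y"
    using assms(1,2) reversed_edge unfolding tail_at_x_def by (blast intro: walk_to.parent)
  with assms(3,4) show ?thesis by (blast intro: walk_to.child)
qed

text \<open>Induction along the walk in \<open>G\<close>, split by how its next edge meets the pair.
  The last two disjuncts of \<open>tail_at_x\<close> arise when the walk goes backwards over the
  covered edge from \<open>y\<close>, passing \<open>y\<close> as a noncollider or as a collider;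
  the second disjunct for \<open>y\<close> in \<open>sim\<close> arises when it goes forwards from
  \<open>x\<close>.\<close>

lemma walk_to_sim: "walk_to G C a d v \<Longrightarrow> sim C a d v"
proof (induction rule: walk_to.induct)
  case start
  then show ?case by (auto simp: sim_def tail_at_x_def intro: walk_to.start)
next
  case (child d v w)
  from child(3) show ?case
  proof (cases rule: edge_cases)
    case reversed
    with child ne show ?thesis by (auto simp: sim_def split: if_splits)
  next
    case into
    with child have "walk_to H C a True x" "walk_to H C a True y"
      by (auto simp: sim_def intro: walk_to.child)
    with into show ?thesis by (auto simp: sim_def)
  next
    case outof
    have "walk_to H C a True w"
    proof (cases "v = x")
      case True
      with child outof tail_at_x_child show ?thesis
        by (cases d) (auto simp: sim_def intro: walk_to.child)
    next
      case False
      with outof have "v = y" by blast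
      with child outof ne tail_at_x_child_y show ?thesis
        by (cases d) (auto simp: sim_def intro: walk_to.child)
    qed
    with outof show ?thesis by (simp add: sim_def)
  next
    case other
    with child show ?thesis by (auto simp: sim_def intro: walk_to.child)
  qed
next
  case (parent v w)
  from parent(3) show ?case
  proof (cases rule: edge_cases)
    case reversed
    with parent ne show ?thesis by (auto simp: sim_def tail_at_x_def)
  next
    case into
    with parent tail_at_x_parent have "walk_to H C a False w"
      by (auto simp: sim_def intro: walk_to.parent split: if_splits)
    with into show ?thesis by (simp add: sim_def)
  next
    case outof
    with parent have "walk_to H C a False w" by (auto simp: sim_def intro: walk_to.parent)
    with outof show ?thesis by (auto simp: sim_def tail_at_x_def)
  next
    case other
    with parent show ?thesis by (auto simp: sim_def intro: walk_to.parent)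
  qed
next
  case (collider v w)
  note anc = ancestors_reverse[OF collider(2)]
  from collider(3) show ?case
  proof (cases rule: edge_cases)
    case reversed
    with collider anc ne show ?thesis by (auto simp: sim_def tail_at_x_def)
  next
    case into
    have "walk_to H C a False w"
    proof (cases "v = x")
      case True
      with collider have "walk_to H C a True x" "walk_to H C a True y" by (auto simp: sim_def)
      \<comment> \<open>In \<open>H\<close> it may be \<open>y\<close> rather than \<open>x\<close>
        that is an ancestor of \<open>C\<close>. Since \<open>w\<close> is a parent of both and both
        are reached with arrowhead, the collider can be placed at either.\<close>
      with True anc into show ?thesis by (blast intro: walk_to.collider)
    next
      case False
      with into ne anc have "v = y" "y \<in> ancestors H C" by auto
      with collider into ne tail_at_x_parent show ?thesis
        by (auto simp: sim_def intro: walk_to.collider)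
    qed
    with into show ?thesis by (simp add: sim_def)
  next
    case outof
    with collider anc have "walk_to H C a False w" by (auto simp: sim_def intro: walk_to.collider)
    with outof show ?thesis by (auto simp: sim_def tail_at_x_def)
  next
    case other
    with collider anc show ?thesis by (auto simp: sim_def intro: walk_to.collider)
  qed
qed

text \<open>At the end of a walk the kind of arrival is irrelevant. A walk standing at the other
  vertex of the pair is prolonged over the reversed edge.\<close>

lemma sim_imp_walk_to:
  assumes "sim C a d v" "v \<notin> C"
  shows "\<exists>d'. walk_to H C a d' v"
proof -
  have "\<exists>d. walk_to H C a d x" if "tail_at_x C a"
    using that reversed_edge unfolding tail_at_x_def by (blast intro: walk_to.child)
  moreover have "\<exists>d. walk_to H C a d y" if "tail_at_x C a" "x \<notin> C"
    using that reversed_edge unfolding tail_at_x_def by (blast intro: walk_to.parent)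
  ultimately show ?thesis using assms by (auto simp: sim_def split: if_splits)
qed

lemma d_separated_reverse:
  assumes "A \<inter> C = {}" "B \<inter> C = {}" "d_separated H A B C"
  shows "d_separated G A B C"
proof -
  have "b \<notin> C" if "b \<in> B" for b using that assms(2) by blast
  then show ?thesis
    using assms(3) walk_to_sim sim_imp_walk_to
    unfolding d_separated_iff_walk_to[OF acyclic assms(1)]
      d_separated_iff_walk_to[OF acyclic_reverse assms(1)] by metis
qed

lemma adjacent_reverse: "adjacent H u v \<longleftrightarrow> adjacent G u v"
  using edge unfolding adjacent_def reverse_def by auto

text \<open>In both graphs every further parent of the head of the covered edge is also a parent of
  its tail, so this edge lies in no v-structure.\<close>

lemma v_structures_reverse: "v_structures H = v_structures G"
proof -
  have "(i, k, j) \<in> v_structures H \<longleftrightarrow> (i, k, j) \<in> v_structures G" for i k j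
  proof -
    have "adjacent G i j" if "i \<noteq> j" "(i, k) \<in> G" "(j, k) \<in> G" "(i, k) = (x, y) \<or> (j, k) = (x, y)"
      using that parents_iff[of i] parents_iff[of j] by (auto simp: adjacent_def)
    moreover have "adjacent G i j"
      if "i \<noteq> j" "(i, k) \<in> H" "(j, k) \<in> H" "(i, k) = (y, x) \<or> (j, k) = (y, x)"
      using that parents_iff[of i] parents_iff[of j] by (auto simp: adjacent_def reverse_def)
    ultimately show ?thesis
      unfolding v_structures_def by (auto simp: adjacent_reverse) (auto simp: reverse_def)
  qed
  then show ?thesis by auto
qed

end

text \<open>Chickering's choice of an edge, extremal for the order of \<open>G\<close>. A parent of
  \<open>x\<close> that is no parent of \<open>y\<close> would give a v-structure at
  \<open>x\<close> in \<open>H\<close> but not in \<open>G\<close>. A parent \<open>w\<close> of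
  \<open>y\<close> that is not adjacent to \<open>x\<close> would give one at \<open>y\<close> in
  \<open>G\<close> but not in \<open>H\<close>, and \<open>x \<rightarrow> w\<close> would give the
  cycle \<open>x \<rightarrow> w \<rightarrow> y \<rightarrow> x\<close> in
  \<open>H\<close>.\<close>

lemma covered_difference:
  assumes G: "dag p G" and H: "dag p H"
    and adj: "\<And>i j. adjacent G i j \<longleftrightarrow> adjacent H i j"
    and vs: "v_structures G = v_structures H" and ne: "G \<noteq> H"
  obtains x y where "covered G x y" "(y, x) \<in> H"
proof -
  define E where "E = {(x, y) \<in> G. (y, x) \<in> H}"
  have acG: "acyclic G" and acH: "acyclic H" using G H by (auto simp: dag_def)
  have fin: "finite G" using G finite_subset unfolding dag_def by blast
  have HG: "(u, v) \<in> H" if "(u, v) \<in> G" "(u, v) \<notin> E" for u v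
    using that adj[of u v] unfolding E_def adjacent_def by auto
  have "E \<noteq> {}"
  proof
    assume "E = {}"
    with HG have "G \<subseteq> H" by auto
    moreover have "H \<subseteq> G"
      using \<open>G \<subseteq> H\<close> adj acyclic_asym[OF acH] unfolding adjacent_def by (auto; metis subsetD)
    ultimately show False using ne by blast
  qed
  have "wf G" using finite_acyclic_wf[OF fin acG] .
  then have "wf (G\<^sup>+)" by (rule wf_trancl)
  moreover have "wf ((G\<inverse>)\<^sup>+)" using finite_acyclic_wf_converse[OF fin acG] by (rule wf_trancl)
  moreover obtain y0 where "y0 \<in> snd ` E" using \<open>E \<noteq> {}\<close> by blast
  \<comment> \<open>\<open>y\<close> is the head of an edge in \<open>E\<close> and none of its
    proper ancestors in \<open>G\<close> is such a head. Next, \<open>x\<close> is chosen among the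
    tails of edges in \<open>E\<close> into \<open>y\<close> so that no proper descendant of
    \<open>x\<close> is such a tail.\<close>
  ultimately obtain y where y: "y \<in> snd ` E" "\<And>z. (z, y) \<in> G\<^sup>+ \<Longrightarrow> z \<notin> snd ` E"
    using wfE_min[of "G\<^sup>+" y0 "snd ` E"] by metis
  then obtain x0 where "x0 \<in> {x. (x, y) \<in> E}" by auto
  with \<open>wf ((G\<inverse>)\<^sup>+)\<close> obtain x where x: "(x, y) \<in> E"
    "\<And>z. (z, x) \<in> (G\<inverse>)\<^sup>+ \<Longrightarrow> (z, y) \<notin> E"
    using wfE_min[of "(G\<inverse>)\<^sup>+" x0 "{x. (x, y) \<in> E}"] by (metis mem_Collect_eq)
  have xy: "(x, y) \<in> G" "(y, x) \<in> H" using x(1) by (auto simp: E_def)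
  have min: "(u, v) \<in> H" if "(u, v) \<in> G" "(v, y) \<in> G" for u v
  proof (rule HG[OF that(1)])
    show "(u, v) \<notin> E" using y(2)[of v] that(2) by force
  qed
  have max: "(v, y) \<in> H" if "(v, y) \<in> G" "(x, v) \<in> G" for v
  proof (rule HG[OF that(1)])
    show "(v, y) \<notin> E" using x(2)[of v] that(2) by (simp add: r_into_trancl)
  qed
  have "(z, y) \<in> G" if z: "(z, x) \<in> G" for z
  proof (rule ccontr)
    assume n: "(z, y) \<notin> G"
    have "(y, z) \<notin> G" using acG z xy(1) acyclic_asym
      by (meson acyclic_def r_into_trancl' trancl_trans)
    with n have na: "\<not> adjacent G z y" by (simp add: adjacent_def)
    have "z \<noteq> y" using acyclic_asym[OF acG xy(1)] z by blast
    with na min[OF z xy(1)] xy(2) adj have "(z, x, y) \<in> v_structures H"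
      by (simp add: v_structures_def)
    then have "(z, x, y) \<in> v_structures G" by (simp only: vs)
    with acyclic_asym[OF acG xy(1)] show False by (simp add: v_structures_def)
  qed
  moreover have "(w, x) \<in> G" if w: "(w, y) \<in> G" "w \<noteq> x" for w
  proof (rule ccontr)
    assume n: "(w, x) \<notin> G"
    show False
    proof (cases "(x, w) \<in> G")
      case False
      with n w xy(1) have "(w, y, x) \<in> v_structures G" by (simp add: v_structures_def adjacent_def)
      then have "(w, y, x) \<in> v_structures H" by (simp only: vs)
      with acyclic_asym[OF acH xy(2)] show False by (simp add: v_structures_def)
    next
      case True
      have "(w, y) \<in> H" "(x, w) \<in> H" using max[OF w(1) True] min[OF True w(1)] by auto
      with xy(2) acH show False by (meson acyclic_def r_into_trancl' trancl_trans)
    qed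
  qed
  ultimately have "covered G x y" using xy(1) by (auto simp: covered_def parents_def)
  with xy(2) that show ?thesis by blast
qed

text \<open>Reversing the edge from \<open>covered_difference\<close> brings \<open>G\<close> one
  edge closer to \<open>H\<close> and keeps adjacencies and v-structures. The statement for the new
  graph is transported back by \<open>d_separated_reverse\<close>.\<close>

lemma d_separated_mono:
  assumes "dag p G" "dag p H" "\<And>i j. adjacent G i j \<longleftrightarrow> adjacent H i j"
    and "v_structures G = v_structures H" and "A \<inter> C = {}" "B \<inter> C = {}" "d_separated H A B C"
  shows "d_separated G A B C"
  using assms
proof (induction "card (G - H)" arbitrary: G rule: less_induct)
  case less
  show ?case
  proof (cases "G = H")
    case True
    with less.prems show ?thesis by simp
  next
    case False
    then obtain x y where xy: "covered G x y" "(y, x) \<in> H"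
      using covered_difference less.prems(1-4) by metis
    interpret covered_edge G x y
      using xy(1) less.prems(1) by unfold_locales (auto simp: dag_def)
    let ?G = "reverse G x y"
    have G: "dag p ?G"
      using less.prems(1) acyclic_reverse edge by (auto simp: dag_def reverse_def)
    have "(x, y) \<notin> H" using xy(2) less.prems(2) acyclic_asym by (metis dag_def)
    then have "?G - H \<subset> G - H" using xy(2) edge by (auto simp: reverse_def)
    moreover have "finite G" using less.prems(1) finite_subset unfolding dag_def by blast
    ultimately have "card (?G - H) < card (G - H)" by (simp add: psubset_card_mono)
    from less.hyps[OF this G less.prems(2)] less.prems(3-7)
    have "d_separated ?G A B C" by (simp add: adjacent_reverse v_structures_reverse)
    with less.prems(5,6) show ?thesis by (rule d_separated_reverse)
  qed
qed

section \<open>Skeletons, and the criterion for Markov equivalence\<close>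

lemma skeleton_iff_adjacent: "{i, j} \<in> skeleton G \<longleftrightarrow> adjacent G i j"
  unfolding skeleton_def adjacent_def by (auto simp: doubleton_eq_iff)

lemma skeleton_cong:
  assumes "\<And>u v. adjacent G u v \<longleftrightarrow> adjacent H u v"
  shows "skeleton G = skeleton H"
proof -
  have "skeleton F = {{u, v} | u v. adjacent F u v}" for F
    unfolding skeleton_def adjacent_def by (auto simp: insert_commute)
  with assms show ?thesis by simp
qed

lemma skeleton_remove:
  assumes "(v, u) \<notin> G"
  shows "skeleton (G - {(u, v)}) = skeleton G - {{u, v}}"
proof
  show "skeleton (G - {(u, v)}) \<subseteq> skeleton G - {{u, v}}"
  proof
    fix e assume "e \<in> skeleton (G - {(u, v)})"
    then obtain i j where e: "e = {i, j}" "(i, j) \<in> G" "(i, j) \<noteq> (u, v)"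
      unfolding skeleton_def by blast
    with assms have "{i, j} \<noteq> {u, v}" by (metis doubleton_eq_iff)
    with e show "e \<in> skeleton G - {{u, v}}" unfolding skeleton_def by blast
  qed
  show "skeleton G - {{u, v}} \<subseteq> skeleton (G - {(u, v)})"
  proof
    fix e assume "e \<in> skeleton G - {{u, v}}"
    then obtain i j where e: "e = {i, j}" "(i, j) \<in> G" "{i, j} \<noteq> {u, v}"
      unfolding skeleton_def by blast
    then have "(i, j) \<in> G - {(u, v)}" by blast
    with e(1) show "e \<in> skeleton (G - {(u, v)})" unfolding skeleton_def by blast
  qed
qed

lemma skeleton_diff_insert:
  assumes "(v, u) \<notin> H"
  shows "skeleton (H - insert (u, v) G) = skeleton (H - G) - {{u, v}}"
proof -
  have "H - insert (u, v) G = H - G - {(u, v)}" by blast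
  with skeleton_remove[of v u "H - G"] assms show ?thesis by (metis DiffD1)
qed

theorem markov_equivalentI:
  assumes "dag p G" "dag p H" "skeleton G = skeleton H" "v_structures G = v_structures H"
  shows "markov_equivalent p G H"
proof -
  have "adjacent G i j \<longleftrightarrow> adjacent H i j" for i j
    using assms(3) by (metis skeleton_iff_adjacent)
  then show ?thesis
    unfolding markov_equivalent_def disjoint3_def
    using assms d_separated_mono[of p G H] d_separated_mono[of p H G] by metis
qed

section \<open>Events with probability tending to one\<close>

lemma whp_mono:
  assumes "whp M Q" "\<And>n \<omega>. \<omega> \<in> space M \<Longrightarrow> Q n \<omega> \<Longrightarrow> R n \<omega>"
  shows "whp M R"
proof -
  obtain E where E: "\<And>n. E n \<in> sets M" "\<And>n. E n \<subseteq> {\<omega> \<in> space M. Q n \<omega>}"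
    and lim: "(\<lambda>n. measure M (E n)) \<longlonglongrightarrow> 1"
    using assms(1) unfolding whp_def by auto
  have "E n \<subseteq> {\<omega> \<in> space M. R n \<omega>}" for n using E(2)[of n] assms(2)[of _ n] by blast
  with E(1) lim show ?thesis unfolding whp_def by blast
qed

lemma whp_conj:
  assumes "prob_space M" "whp M Q" "whp M R"
  shows "whp M (\<lambda>n \<omega>. Q n \<omega> \<and> R n \<omega>)"
proof -
  interpret prob_space M by fact
  obtain E where E: "\<And>n. E n \<in> sets M" "\<And>n. E n \<subseteq> {\<omega> \<in> space M. Q n \<omega>}"
    and limE: "(\<lambda>n. measure M (E n)) \<longlonglongrightarrow> 1"
    using assms(2) unfolding whp_def by auto
  obtain F where F: "\<And>n. F n \<in> sets M" "\<And>n. F n \<subseteq> {\<omega> \<in> space M. R n \<omega>}"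
    and limF: "(\<lambda>n. measure M (F n)) \<longlonglongrightarrow> 1"
    using assms(3) unfolding whp_def by auto
  \<comment> \<open>Bonferroni's inequality, applied to the measurable events inside
    \<open>Q\<close> and \<open>R\<close>.\<close>
  have lower: "prob (E n) + prob (F n) - 1 \<le> prob (E n \<inter> F n)" for n
  proof -
    have "prob (E n) = prob (E n - F n) + prob (E n \<inter> F n)"
      using E(1) F(1) finite_measure_Diff'[of "E n" "F n"] by auto
    moreover have "prob (E n \<union> F n) = prob (E n - F n) + prob (F n)"
      using E(1) F(1) by (subst finite_measure_Union[symmetric]) (auto simp: Un_Diff_cancel2)
    moreover have "prob (E n \<union> F n) \<le> 1" by simp
    ultimately show ?thesis by linarith
  qed
  have "(\<lambda>n. prob (E n) + prob (F n) - 1) \<longlonglongrightarrow> 1 + 1 - 1"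
    by (intro tendsto_intros limE limF)
  then have "(\<lambda>n. prob (E n) + prob (F n) - 1) \<longlonglongrightarrow> 1" by simp
  from tendsto_sandwich[OF _ _ this tendsto_const, of "\<lambda>n. prob (E n \<inter> F n)"] lower
  have "(\<lambda>n. prob (E n \<inter> F n)) \<longlonglongrightarrow> 1" by simp
  moreover have "E n \<inter> F n \<in> sets M" "E n \<inter> F n \<subseteq> {\<omega> \<in> space M. Q n \<omega> \<and> R n \<omega>}" for n
    using E[of n] F[of n] by auto
  ultimately show ?thesis unfolding whp_def by (intro exI[of _ "\<lambda>n. E n \<inter> F n"]) blast
qed

lemma whp_finite_all:
  assumes "prob_space M" "finite I" "\<And>i. i \<in> I \<Longrightarrow> whp M (Q i)"
  shows "whp M (\<lambda>n \<omega>. \<forall>i\<in>I. Q i n \<omega>)"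
  using assms(2,3)
proof (induction I rule: finite_induct)
  case empty
  then show ?case
    using prob_space.prob_space[OF assms(1)] unfolding whp_def
    by (intro exI[of _ "\<lambda>_. space M"]) auto
next
  case (insert i I)
  then have "whp M (\<lambda>n \<omega>. Q i n \<omega> \<and> (\<forall>i\<in>I. Q i n \<omega>))"
    by (intro whp_conj[OF assms(1)]) auto
  then show ?case by (rule whp_mono) auto
qed

section \<open>Runs of the algorithm\<close>

text \<open>The deterministic part: \<open>f\<close> is the score at one fixed sample, and
  \<open>improves\<close> expresses that this sample lies in the good event.\<close>

locale hgi_run =
  fixes p :: nat and Gs :: digraph and f :: "digraph \<Rightarrow> real"
  assumes dag_Gs: "dag p Gs"
    and improves: "\<lbrakk>dag p (insert (i, j) G); (i, j) \<notin> G; adjacent Gs i j\<rbrakk>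
      \<Longrightarrow> f G < f (insert (i, j) G)"
begin

text \<open>\<open>R\<close> is the set of vertices whose edges have been deleted from \<open>K\<close>, and \<open>H\<close> is a DAG equivalent
  to the true one that extends the edges oriented so far.\<close>

definition extension :: "pdgraph \<Rightarrow> digraph \<Rightarrow> digraph \<Rightarrow> nat set \<Rightarrow> bool" where
  "extension K G H R \<longleftrightarrow> dag p H \<and> skeleton H = skeleton Gs \<and> v_structures H = v_structures Gs
    \<and> G \<subseteq> H \<and> (\<forall>i k j. (i, k, j) \<in> v_structures H \<longrightarrow> (i, k) \<in> G)
    \<and> dir K = {(i, j) \<in> G. i \<notin> R \<and> j \<notin> R} \<and> und K = skeleton (H - G)
    \<and> (\<forall>i j. (i, j) \<in> H - G \<longrightarrow> i \<notin> R \<and> j \<notin> R) \<and> (\<forall>i j. (i, j) \<in> H \<and> i \<in> R \<longrightarrow> j \<in> R)"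

section \<open>The invariant and its preservation by single operations\<close>

lemma
  assumes "extension K G H R"
  shows ext_dag: "dag p H" and ext_skeleton: "skeleton H = skeleton Gs"
    and ext_v_structures: "v_structures H = v_structures Gs"
    and ext_subset: "G \<subseteq> H" and ext_v_dir: "(i, k, j) \<in> v_structures H \<Longrightarrow> (i, k) \<in> G"
    and ext_dir: "(i, j) \<in> dir K \<longleftrightarrow> (i, j) \<in> G \<and> i \<notin> R \<and> j \<notin> R"
    and ext_und: "{i, j} \<in> und K \<longleftrightarrow> (i, j) \<in> H - G \<or> (j, i) \<in> H - G"
    and ext_unremoved: "(i, j) \<in> H - G \<Longrightarrow> i \<notin> R \<and> j \<notin> R"
    and ext_closed: "(i, j) \<in> H \<Longrightarrow> i \<in> R \<Longrightarrow> j \<in> R"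
    and ext_acyclic: "acyclic H" and ext_adjacent: "adjacent H i j \<longleftrightarrow> adjacent Gs i j"
proof -
  note ext = assms[unfolded extension_def]
  show "dag p H" "skeleton H = skeleton Gs" "v_structures H = v_structures Gs" "G \<subseteq> H"
    "(i, k, j) \<in> v_structures H \<Longrightarrow> (i, k) \<in> G" "(i, j) \<in> H - G \<Longrightarrow> i \<notin> R \<and> j \<notin> R"
    "(i, j) \<in> H \<Longrightarrow> i \<in> R \<Longrightarrow> j \<in> R" "(i, j) \<in> dir K \<longleftrightarrow> (i, j) \<in> G \<and> i \<notin> R \<and> j \<notin> R"
    using ext by blast+
  then show "acyclic H" "adjacent H i j \<longleftrightarrow> adjacent Gs i j"
    using skeleton_iff_adjacent[of i j H] skeleton_iff_adjacent[of i j Gs]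
    unfolding dag_def by simp_all
  have "und K = skeleton (H - G)" using ext by blast
  then show "{i, j} \<in> und K \<longleftrightarrow> (i, j) \<in> H - G \<or> (j, i) \<in> H - G"
    using skeleton_iff_adjacent[of i j "H - G"] unfolding adjacent_def by simp
qed

lemma extensionI:
  assumes "dag p H" "skeleton H = skeleton Gs" "v_structures H = v_structures Gs" "G \<subseteq> H"
    and "\<And>i k j. (i, k, j) \<in> v_structures H \<Longrightarrow> (i, k) \<in> G"
    and "dir K = {(i, j) \<in> G. i \<notin> R \<and> j \<notin> R}" "und K = skeleton (H - G)"
    and "\<And>i j. (i, j) \<in> H - G \<Longrightarrow> i \<notin> R \<and> j \<notin> R"
    and "\<And>i j. (i, j) \<in> H \<Longrightarrow> i \<in> R \<Longrightarrow> j \<in> R"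
  shows "extension K G H R"
  using assms unfolding extension_def by blast

lemma ext_pd_adjacent:
  assumes "extension K G H R"
  shows "pd_adjacent K i j \<longleftrightarrow> i \<notin> R \<and> j \<notin> R \<and> adjacent H i j"
  using ext_dir[OF assms, of i j] ext_dir[OF assms, of j i] ext_und[OF assms, of i j]
    ext_unremoved[OF assms, of i j] ext_unremoved[OF assms, of j i] ext_subset[OF assms]
  unfolding pd_adjacent_def adjacent_def by blast

text \<open>The same \<open>H\<close> remains a witness: the edge only moves from
  \<open>H - G\<close> to \<open>G\<close>.\<close>

lemma ext_orient:
  assumes "extension K G H R" "{i, j} \<in> und K" "(i, j) \<in> H"
  shows "extension (orient K i j) (insert (i, j) G) H R"
proof -
  note e = assms(1)
  have n: "(j, i) \<notin> H" using acyclic_asym[OF ext_acyclic[OF e] assms(3)] .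
  then have "(i, j) \<in> H - G" using assms(2) ext_und[OF e] by blast
  then have "i \<notin> R" "j \<notin> R" using ext_unremoved[OF e] by auto
  moreover have "skeleton (H - insert (i, j) G) = skeleton (H - G) - {{i, j}}"
    using n by (rule skeleton_diff_insert)
  moreover have "dir K = {(u, v) \<in> G. u \<notin> R \<and> v \<notin> R}" "und K = skeleton (H - G)"
    using e unfolding extension_def by blast+
  ultimately have "dir (orient K i j) = {(u, v) \<in> insert (i, j) G. u \<notin> R \<and> v \<notin> R}"
    "und (orient K i j) = skeleton (H - insert (i, j) G)"
    unfolding orient_def by auto
  moreover have "insert (i, j) G \<subseteq> H" using ext_subset[OF e] assms(3) by simp
  moreover have "(u, v) \<in> insert (i, j) G" if "(u, v, w) \<in> v_structures H" for u v w
    using ext_v_dir[OF e that] by simp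
  moreover have "u \<notin> R \<and> v \<notin> R" if "(u, v) \<in> H - insert (i, j) G" for u v
    using that ext_unremoved[OF e, of u v] by blast
  ultimately show ?thesis
    by - (rule extensionI[OF ext_dag[OF e] ext_skeleton[OF e] ext_v_structures[OF e]
        _ _ _ _ _ ext_closed[OF e]])
qed

text \<open>As in the algorithm of Dor and Tarsi, a vertex satisfying (a) and (b) can be made a sink.\<close>

lemma ext_sink:
  assumes e: "extension K G H R" and "sink K j" "neighbours_joined K j" "j \<notin> R"
  defines "H' \<equiv> {(u, v) \<in> H. u = j \<longrightarrow> v \<in> R} \<union> {(u, j) | u. (j, u) \<in> H \<and> u \<notin> R}"
  shows "extension K G H' R"
proof -
  note ac = ext_acyclic[OF e]
  have jG: "v \<in> R" if "(j, v) \<in> G" for v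
    using that assms(2,4) ext_dir[OF e] unfolding sink_def by blast
  have edge: "(u \<in> insert j R \<longrightarrow> v \<in> R \<and> (u, v) \<in> H) \<and> (v = j \<or> (u, v) \<in> H)"
    if "(u, v) \<in> H'" for u v
    using that ext_closed[OF e] acyclic_irrefl[OF ac] unfolding H'_def by blast
  \<comment> \<open>New edges only enter \<open>j\<close>, and from \<open>j\<close> every path
    stays in the closed set \<open>R\<close> along edges of \<open>H\<close>. So a cycle of
    \<open>H'\<close> would be a cycle of \<open>H\<close>, whether or not it starts in
    \<open>insert j R\<close>.\<close>
  have path: "(u \<in> insert j R \<longrightarrow> v \<in> R \<and> (u, v) \<in> H\<^sup>+) \<and> (v \<in> insert j R \<or> (u, v) \<in> H\<^sup>+)"
    if "(u, v) \<in> H'\<^sup>+" for u v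
    using that
  proof induction
    case (base v)
    with edge show ?case by blast
  next
    case (step v w)
    with edge[of v w] trancl_into_trancl[of u v H w] show ?case by blast
  qed
  have "acyclic H'"
    unfolding acyclic_def using path ac unfolding acyclic_def by blast
  moreover have "H' \<subseteq> {1..p} \<times> {1..p}"
    using ext_dag[OF e] unfolding dag_def H'_def by auto
  ultimately have "dag p H'" by (simp add: dag_def)
  have adj: "adjacent H' u v \<longleftrightarrow> adjacent H u v" for u v
    unfolding adjacent_def H'_def by auto
  then have skel: "skeleton H' = skeleton H" by (rule skeleton_cong)
  have sub: "G \<subseteq> H'" using ext_subset[OF e] jG unfolding H'_def by auto
  have "adjacent (H' - G) u v \<longleftrightarrow> adjacent (H - G) u v" for u v
    using jG ext_subset[OF e] acyclic_asym[OF ac] unfolding adjacent_def H'_def by blast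
  then have und: "skeleton (H' - G) = skeleton (H - G)" by (rule skeleton_cong)
  have K: "dir K = {(u, v) \<in> G. u \<notin> R \<and> v \<notin> R}" "und K = skeleton (H - G)"
    using e unfolding extension_def by blast+
  have new: "(u, v) \<in> H \<or> v = j \<and> (j, u) \<in> H \<and> u \<notin> R" if "(u, v) \<in> H'" for u v
    using that unfolding H'_def by blast
  \<comment> \<open>Condition (b) joins the tail of a flipped edge to all other parents of
    \<open>j\<close>, so flipping creates no v-structure at \<open>j\<close>.\<close>
  have joined: "adjacent H u l"
    if "(j, u) \<in> H" "u \<notin> R" "(l, j) \<in> H'" "l \<noteq> u" for u l
  proof -
    have "{u, j} \<in> und K" using that(1,2) jG ext_und[OF e] by blast
    moreover have "l \<notin> R" using that(3) ext_closed[OF e] assms(4) unfolding H'_def by blast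
    moreover have "adjacent H l j" using that(3) adj[of l j] by (simp add: adjacent_def)
    ultimately have "{u, j} \<in> und K" "pd_adjacent K l j"
      using assms(4) ext_pd_adjacent[OF e] by simp_all
    then have "pd_adjacent K u l"
      using assms(3) that(4) unfolding neighbours_joined_def by blast
    then show ?thesis using ext_pd_adjacent[OF e] by blast
  qed
  have vs: "(i, k, l) \<in> v_structures H' \<longleftrightarrow> (i, k, l) \<in> v_structures H" for i k l
  proof
    assume v: "(i, k, l) \<in> v_structures H"
    \<comment> \<open>\<open>ext_v_dir\<close> speaks of the first edge of a triple only; the
      opposite order supplies the second one.\<close>
    then have "(l, k, i) \<in> v_structures H" by (auto simp: v_structures_def adjacent_def)
    with v ext_v_dir[OF e] sub have "(i, k) \<in> H'" "(l, k) \<in> H'" by blast+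
    with v adj show "(i, k, l) \<in> v_structures H'" by (simp add: v_structures_def)
  next
    assume "(i, k, l) \<in> v_structures H'"
    then have v: "(i, k) \<in> H'" "(l, k) \<in> H'" "i \<noteq> l" "\<not> adjacent H i l" "\<not> adjacent H l i"
      using adj by (auto simp: v_structures_def adjacent_def)
    have "(i, k) \<in> H" using v(2-5) joined[of i l] new[OF v(1)] by blast
    moreover have "(l, k) \<in> H" using v(1,3-5) joined[of l i] new[OF v(2)] by blast
    ultimately show "(i, k, l) \<in> v_structures H" using v by (simp add: v_structures_def)
  qed
  then have vs_eq: "v_structures H' = v_structures H" by auto
  have "i \<notin> R \<and> k \<notin> R" if "(i, k) \<in> H' - G" for i k
    using that new[of i k] ext_unremoved[OF e, of i k] assms(4) by blast
  moreover have "k \<in> R" if "(i, k) \<in> H'" "i \<in> R" for i k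
    using that ext_closed[OF e] unfolding H'_def by blast
  moreover have "skeleton H' = skeleton Gs" "v_structures H' = v_structures Gs"
    using skel vs_eq ext_skeleton[OF e] ext_v_structures[OF e] by simp_all
  moreover have "(i, k) \<in> G" if "(i, k, l) \<in> v_structures H'" for i k l
    using that vs ext_v_dir[OF e] by blast
  moreover have "und K = skeleton (H' - G)" using K(2) und by simp
  ultimately show ?thesis
    by - (rule extensionI[OF \<open>dag p H'\<close> _ _ sub _ K(1)])
qed

text \<open>If \<open>H\<close> had \<open>j \<rightarrow> i\<close> instead, each rule would
  produce a directed cycle in \<open>H\<close> or two nonadjacent parents of \<open>i\<close>, one
  of them joined to \<open>i\<close> by a still undirected edge.\<close>

lemma meek_sound:
  assumes e: "extension K G H R" and "meek K i j"
  shows "(i, j) \<in> H"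
proof (rule ccontr)
  assume n: "(i, j) \<notin> H"
  have und: "{i, j} \<in> und K" using assms(2) by (simp add: meek_def)
  with n have ji: "(j, i) \<in> H" "(j, i) \<notin> G" "i \<notin> R" "j \<notin> R"
    using ext_und[OF e] ext_unremoved[OF e] by blast+
  note ac = ext_acyclic[OF e]
  have chain: "(v, w) \<notin> H" if "(u, v) \<in> H" "(w, u) \<in> H" for u v w
    using that ac by (meson acyclic_def r_into_trancl' trancl_trans)
  \<comment> \<open>All edges of v-structures are already in \<open>G\<close>, so an edge into
    \<open>i\<close> outside \<open>G\<close> belongs to none.\<close>
  have shielded: "pd_adjacent K u l"
    if "(u, i) \<in> H - G" "(l, i) \<in> H" "u \<noteq> l" "l \<notin> R" for u l
    using that ext_v_dir[OF e, of u i l] ext_pd_adjacent[OF e] ext_unremoved[OF e]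
    unfolding v_structures_def by blast
  have into_i: "(u, i) \<in> H - G" if "{i, u} \<in> und K" "(w, i) \<in> H" "(u, w) \<in> H" for u w
    using that chain[OF that(2,3)] ext_und[OF e] by blast
  have dir: "(u, w) \<in> H \<and> u \<notin> R \<and> w \<notin> R" if "(u, w) \<in> dir K" for u w
    using that ext_dir[OF e] ext_subset[OF e] by blast
  from assms(2) consider
    (R1) h where "(h, i) \<in> dir K" "h \<noteq> j" "\<not> pd_adjacent K h j"
  | (R2) h where "(i, h) \<in> dir K" "(h, j) \<in> dir K"
  | (R3) k l where "{i, k} \<in> und K" "{i, l} \<in> und K" "(k, j) \<in> dir K" "(l, j) \<in> dir K"
      "k \<noteq> l" "\<not> pd_adjacent K k l"
  | (R4) k l where "{i, k} \<in> und K" "(k, l) \<in> dir K" "(l, j) \<in> dir K" "pd_adjacent K i l"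
      "k \<noteq> j" "\<not> pd_adjacent K k j"
    unfolding meek_def by blast
  then show False
  proof cases
    case R1
    then have "pd_adjacent K j h" using shielded[of j h] ji dir[of h i] by blast
    with R1(3) show False by (auto simp: pd_adjacent_def insert_commute)
  next
    case R2
    then show False using dir chain ji(1) by blast
  next
    case R3
    have "(k, i) \<in> H - G" "(l, i) \<in> H" using into_i[OF _ ji(1)] R3(1-4) dir by blast+
    with R3 show False using shielded[of k l] dir by blast
  next
    case R4
    \<comment> \<open>Acyclicity orients \<open>l \<rightarrow> i\<close> because of
      \<open>l \<rightarrow> j \<rightarrow> i\<close>, and then \<open>k \<rightarrow> i\<close>
      because of \<open>k \<rightarrow> l \<rightarrow> i\<close>. So \<open>k\<close> and
      \<open>j\<close> are nonadjacent parents of \<open>i\<close>.\<close>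
    have "(i, l) \<notin> H" using chain[OF ji(1)] R4(3) dir by blast
    then have "(l, i) \<in> H" using R4(4) ext_pd_adjacent[OF e] by (auto simp: adjacent_def)
    then have "(k, i) \<in> H - G" using into_i[OF R4(1)] R4(2) dir by blast
    with R4 show False using shielded[of k j] ji by blast
  qed
qed

text \<open>For Meek's rules the current extension already agrees with the orientation; for (a) and
  (b) the one from \<open>ext_sink\<close> does.\<close>

lemma candidate_extension:
  assumes e: "extension K G H R" and "(i, j) \<in> sink_candidates K \<union> meek_candidates K"
  shows "\<exists>H'. extension (orient K i j) (insert (i, j) G) H' R"
proof (cases "(i, j) \<in> meek_candidates K")
  case True
  then have "meek K i j" by (simp add: meek_candidates_def)
  with ext_orient[OF e] meek_sound[OF e] show ?thesis unfolding meek_def by blast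
next
  case False
  with assms(2) have j: "{i, j} \<in> und K" "sink K j" "neighbours_joined K j"
    by (auto simp: sink_candidates_def)
  then have R: "i \<notin> R" "j \<notin> R" using ext_und[OF e] ext_unremoved[OF e] by blast+
  have "i \<noteq> j" using j(1) ext_und[OF e] acyclic_irrefl[OF ext_acyclic[OF e]] by blast
  with j(1) R(1) ext_und[OF e]
  have "(i, j) \<in> {(u, v) \<in> H. u = j \<longrightarrow> v \<in> R} \<union> {(u, j) | u. (j, u) \<in> H \<and> u \<notin> R}"
    by blast
  with ext_orient[OF ext_sink[OF e j(2,3) R(2)] j(1)] show ?thesis by blast
qed

lemma candidate_und:
  "(i, j) \<in> sink_candidates K \<union> meek_candidates K \<Longrightarrow> {i, j} \<in> und K"
  by (auto simp: sink_candidates_def meek_candidates_def meek_def)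

text \<open>Consequently no candidate deteriorates the score, and operations (ii) and (iv) never
  occur.\<close>

lemma candidate_improves:
  assumes e: "extension K G H R" and c: "(i, j) \<in> sink_candidates K \<union> meek_candidates K"
  shows "f G < f (insert (i, j) G)"
proof (rule improves)
  obtain H' where "extension (orient K i j) (insert (i, j) G) H' R"
    using candidate_extension[OF assms] by blast
  then show "dag p (insert (i, j) G)"
    using ext_dag ext_subset acyclic_subset unfolding dag_def by (meson order_trans)
  have und: "{i, j} \<in> und K" using candidate_und[OF c] .
  then show "(i, j) \<notin> G"
    using ext_und[OF e] ext_subset[OF e] acyclic_asym[OF ext_acyclic[OF e]] by blast
  show "adjacent Gs i j"
    using und ext_und[OF e] ext_adjacent[OF e, symmetric] unfolding adjacent_def by blast
qed

lemma operation_extension: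
  assumes "operation f (K, G) (K', G')" and e: "extension K G H R"
  shows "\<exists>H'. extension K' G' H' R"
  using assms(1)
proof cases
  case (op1 i j)
  with candidate_extension[OF e, of i j] show ?thesis by (auto simp: best_improving_def)
next
  case (op2 i j)
  with candidate_improves[OF e, of i j] show ?thesis by (auto simp: worst_deteriorating_def)
next
  case (op3 i j)
  with candidate_extension[OF e, of i j] show ?thesis by (auto simp: best_improving_def)
next
  case (op4 i j)
  with candidate_improves[OF e, of i j] show ?thesis by (auto simp: worst_deteriorating_def)
qed

text \<open>Only \<open>R\<close> grows. It stays closed under children: an edge of \<open>H\<close>
  leaving a new complete sink is already oriented, yet not in \<open>dir K\<close>, so its head was
  removed before.\<close>

lemma delete_extension:
  assumes e: "extension K G H R"
  shows "extension (delete_complete_sinks K) G H (R \<union> {j. complete_sink K j})"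
proof -
  let ?R = "R \<union> {j. complete_sink K j}"
  have und: "\<not> complete_sink K i \<and> \<not> complete_sink K j" if "(i, j) \<in> H - G" for i j
  proof -
    have "{i, j} \<in> und K" "{j, i} \<in> und K" using that ext_und[OF e] by blast+
    then show ?thesis unfolding complete_sink_def by blast
  qed
  have K: "und K = skeleton (H - G)" using e unfolding extension_def by blast
  then have "und (delete_complete_sinks K) = skeleton (H - G)"
    using und unfolding delete_complete_sinks_def skeleton_def by auto
  moreover have "dir (delete_complete_sinks K) = {(i, j) \<in> G. i \<notin> ?R \<and> j \<notin> ?R}"
    using ext_dir[OF e] unfolding delete_complete_sinks_def by auto
  moreover have "i \<notin> ?R \<and> j \<notin> ?R" if "(i, j) \<in> H - G" for i j
    using that und ext_unremoved[OF e] by blast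
  moreover have "j \<in> ?R" if "(i, j) \<in> H" "i \<in> ?R" for i j
  proof (cases "i \<in> R")
    case True
    with that ext_closed[OF e] show ?thesis by blast
  next
    case False
    with that have "complete_sink K i" by blast
    with that(1) und have "(i, j) \<in> G" "(i, j) \<notin> dir K"
      by (auto simp: complete_sink_def sink_def)
    with False ext_dir[OF e] show ?thesis by blast
  qed
  ultimately show ?thesis
    by - (rule extensionI[OF ext_dag[OF e] ext_skeleton[OF e] ext_v_structures[OF e]
        ext_subset[OF e] ext_v_dir[OF e]])
qed

lemma main_step_extension:
  assumes "main_step f (K, G) (K', G')" "extension K G H R"
  shows "\<exists>H' R'. extension K' G' H' R'"
  using assms(1)
proof cases
  case 1
  with delete_extension[OF assms(2)] show ?thesis by blast
next
  case 2
  with operation_extension[OF _ assms(2)] show ?thesis by blast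
qed

section \<open>The final state of the main loop\<close>

lemma best_improving_nonempty:
  assumes "finite C" "C \<noteq> {}" "\<And>e. e \<in> C \<Longrightarrow> f G < f (insert e G)"
  shows "best_improving f G C \<noteq> {}"
proof -
  let ?g = "\<lambda>e. f (insert e G)"
  have "Max (?g ` C) \<in> ?g ` C" using assms(1,2) by (intro Max_in) auto
  then obtain e where "e \<in> C" "?g e = Max (?g ` C)" by auto
  with assms(1) have "\<forall>e'\<in>C. ?g e' \<le> ?g e" by simp
  with \<open>e \<in> C\<close> assms(3) have "e \<in> best_improving f G C" by (simp add: best_improving_def)
  then show ?thesis by blast
qed

text \<open>Were an edge still undirected, the part of \<open>H\<close> outside \<open>R\<close>
  would have a sink \<open>j\<close> with an incoming edge. Such a \<open>j\<close> satisfies (a)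
  and (b), so it yields a candidate for operation (i), or else it is a complete sink that still has
  an edge to delete.\<close>

lemma final_extension:
  assumes e: "extension K G H R" and final: "\<nexists>t. main_step f (K, G) t"
  shows "G = H"
proof (rule ccontr)
  assume "G \<noteq> H"
  have fixed: "delete_complete_sinks K = K" using final main_step.intros(1) by blast
  have fin: "finite H" using ext_dag[OF e] finite_subset unfolding dag_def by blast
  have "sink_candidates K \<subseteq> H \<union> H\<inverse>"
    using ext_und[OF e] by (auto simp: sink_candidates_def)
  with fin have "finite (sink_candidates K)" by (meson finite_Un finite_converse finite_subset)
  moreover have "best_improving f G (sink_candidates K) = {}"
    using final main_step.intros(2)[OF fixed] operation.op1 by fast
  ultimately have none: "sink_candidates K = {}"
    using best_improving_nonempty candidate_improves[OF e] by (metis UnI1 surj_pair)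
  define F where "F = {(i, j) \<in> H. i \<notin> R \<and> j \<notin> R}"
  have F: "F \<subseteq> H" by (auto simp: F_def)
  obtain i0 j0 where "(i0, j0) \<in> H - G" using \<open>G \<noteq> H\<close> ext_subset[OF e] by auto
  then have "j0 \<in> Range F" using ext_unremoved[OF e] by (auto simp: F_def)
  moreover have "wf (F\<inverse>)"
    using finite_acyclic_wf_converse[of F] F fin ext_acyclic[OF e] acyclic_subset finite_subset
    by blast
  ultimately obtain j where j: "j \<in> Range F" "\<And>k. (k, j) \<in> F\<inverse> \<Longrightarrow> k \<notin> Range F"
    using wfE_min[of "F\<inverse>" j0 "Range F"] by metis
  from j(1) obtain i where i: "(i, j) \<in> H" "i \<notin> R" "j \<notin> R" unfolding F_def by blast
  have out: "(j, k) \<notin> F" for k using j(2)[of k] by auto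
  then have sink: "sink K j"
    using ext_dir[OF e] ext_subset[OF e] unfolding sink_def F_def by blast
  have into: "(k, j) \<in> H" if "pd_adjacent K k j" for k
    using that ext_pd_adjacent[OF e] out[of k] unfolding adjacent_def F_def by blast
  have "pd_adjacent K k l" if "{k, j} \<in> und K" "pd_adjacent K l j" "l \<noteq> k" for k l
  \<comment> \<open>Two nonadjacent parents of \<open>j\<close> would form a v-structure, whose
    edges are all oriented, whereas \<open>k - j\<close> is undirected.\<close>
  proof (rule ccontr)
    assume n: "\<not> pd_adjacent K k l"
    have kj: "(k, j) \<in> H" "(l, j) \<in> H" "k \<notin> R" "l \<notin> R"
      using that into ext_pd_adjacent[OF e] unfolding pd_adjacent_def by blast+
    with n ext_pd_adjacent[OF e] that(3) have "(k, j, l) \<in> v_structures H"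
      by (auto simp: v_structures_def)
    with ext_v_dir[OF e] have "(k, j) \<in> G" by blast
    with that(1) kj(1) ext_und[OF e] acyclic_asym[OF ext_acyclic[OF e]] show False by blast
  qed
  then have "neighbours_joined K j" unfolding neighbours_joined_def by blast
  with none sink have no_und: "{k, j} \<notin> und K" for k by (auto simp: sink_candidates_def)
  then have "complete_sink K j" using sink by (simp add: complete_sink_def)
  then have "(i, j) \<notin> dir (delete_complete_sinks K)" by (simp add: delete_complete_sinks_def)
  with fixed have "(i, j) \<notin> dir K" by simp
  with i no_und ext_dir[OF e] ext_und[OF e] show False by blast
qed

lemma main_phase:
  assumes e: "extension K\<^sub>0 G\<^sub>0 H\<^sub>0 R\<^sub>0" and run: "runs_to (main_step f) (K\<^sub>0, G\<^sub>0) (K, G)"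
  shows "markov_equivalent p G Gs"
proof -
  have "\<exists>H R. extension (fst s) (snd s) H R" if "(main_step f)\<^sup>*\<^sup>* (K\<^sub>0, G\<^sub>0) s" for s
    using that
  proof induction
    case base
    with e show ?case by auto
  next
    case (step s t)
    then show ?case using main_step_extension by (metis prod.collapse)
  qed
  with run obtain H R where "extension K G H R" unfolding runs_to_def by fastforce
  moreover from this run have "G = H" unfolding runs_to_def using final_extension by blast
  ultimately have "extension K G G R" by simp
  from ext_dag[OF this] dag_Gs ext_skeleton[OF this] ext_v_structures[OF this]
  show ?thesis by (rule markov_equivalentI)
qed

section \<open>The v-structure phase\<close>

lemma insert_improves:
  assumes "G \<subseteq> Gs" "(i, j) \<in> Gs"
  shows "f G \<le> f (insert (i, j) G)" "(i, j) \<notin> G \<Longrightarrow> f G < f (insert (i, j) G)"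
proof -
  have "insert (i, j) G \<subseteq> Gs" using assms by simp
  then have "dag p (insert (i, j) G)"
    using dag_Gs acyclic_subset unfolding dag_def by (meson order_trans)
  then show less: "f G < f (insert (i, j) G)" if "(i, j) \<notin> G"
    using improves that assms(2) by (simp add: adjacent_def)
  show "f G \<le> f (insert (i, j) G)"
  proof (cases "(i, j) \<in> G")
    case True
    then show ?thesis by (simp add: insert_absorb)
  next
    case False
    with less show ?thesis by simp
  qed
qed

text \<open>Two edges enter at once, and one of them may be present already; hence one strict and
  possibly one weak inequality from \<open>insert_improves\<close>.\<close>

lemma add_vs_improves:
  assumes "G \<subseteq> Gs" "t \<in> v_structures Gs" "add_vs G t \<noteq> G"
  shows "f G < f (add_vs G t)"
proof -
  obtain i k j where t: "t = (i, k, j)" by (cases t)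
  have edges: "(i, k) \<in> Gs" "(j, k) \<in> Gs" using assms(2) t by (auto simp: v_structures_def)
  have eq: "add_vs G t = insert (i, k) (insert (j, k) G)" using t by (auto simp: add_vs_def)
  have sub: "insert (j, k) G \<subseteq> Gs" using assms(1) edges by simp
  show ?thesis
  proof (cases "(j, k) \<in> G")
    case True
    then have "insert (j, k) G = G" by auto
    with eq assms(1,3) edges(1) insert_improves(2)[of G i k] show ?thesis
      by (auto simp: insert_absorb)
  next
    case False
    with insert_improves(2)[OF assms(1) edges(2)] insert_improves(1)[OF sub edges(1)] eq
    show ?thesis by simp
  qed
qed

text \<open>As long as the graph stays inside \<open>Gs\<close>, neither a cycle nor a reversed edge
  can arise, so no v-structure is ever blocked.\<close>

lemma v_structure_candidates:
  assumes "G \<subseteq> Gs"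
  shows "vs_candidates (v_structures Gs) G = v_structures Gs"
proof -
  have ac: "acyclic Gs" using dag_Gs by (simp add: dag_def)
  have "acyclic (add_vs G t) \<and> \<not> vs_conflict G t" if "t \<in> v_structures Gs" for t
  proof -
    obtain i k j where t: "t = (i, k, j)" by (cases t)
    with that have e: "(i, k) \<in> Gs" "(j, k) \<in> Gs" by (auto simp: v_structures_def)
    then have "add_vs G t \<subseteq> Gs" using assms t by (auto simp: add_vs_def)
    moreover have "\<not> vs_conflict G t"
      using e assms acyclic_asym[OF ac] t by (auto simp: vs_conflict_def v_structures_def)
    ultimately show ?thesis using acyclic_subset[OF ac] by blast
  qed
  then show ?thesis by (auto simp: vs_candidates_def)
qed

text \<open>The true DAG itself is the first extension, with nothing removed yet.\<close>

lemma vs_phase: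
  assumes run: "runs_to (vs_step f (v_structures Gs)) (PDGraph {} (skeleton Gs), {}) (K, G)"
  shows "extension K G Gs {}"
proof -
  let ?U = "v_structures Gs"
  have ac: "acyclic Gs" using dag_Gs by (simp add: dag_def)
  have "snd s \<subseteq> Gs \<and> dir (fst s) = snd s \<and> und (fst s) = skeleton (Gs - snd s)"
    if "(vs_step f ?U)\<^sup>*\<^sup>* (PDGraph {} (skeleton Gs), {}) s" for s
    using that
  proof induction
    case base
    show ?case by simp
  next
    case (step s t)
    from step(2) show ?case
    proof cases
      case (1 i k j G K)
      have G: "G \<subseteq> Gs" "dir K = G" "und K = skeleton (Gs - G)" using step(3) 1(1) by auto
      have e: "(i, k) \<in> Gs" "(j, k) \<in> Gs"
        using 1(3) by (auto simp: vs_candidates_def v_structures_def)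
      have "skeleton (Gs - insert (u, v) F) = skeleton (Gs - F) - {{u, v}}"
        if "(u, v) \<in> Gs" for u v F
        using acyclic_asym[OF ac that] by (rule skeleton_diff_insert)
      from this[OF e(2), of "insert (i, k) G"] this[OF e(1), of G]
      have "und (orient (orient K i k) j k) = skeleton (Gs - insert (j, k) (insert (i, k) G))"
        by (simp add: orient_def G(3))
      moreover have "add_vs G (i, k, j) = insert (j, k) (insert (i, k) G)"
        by (auto simp: add_vs_def)
      ultimately show ?thesis using 1(2) e G by (simp add: orient_def)
    qed
  qed
  from this[of "(K, G)"] run
  have G: "G \<subseteq> Gs" "dir K = G" "und K = skeleton (Gs - G)" by (auto simp: runs_to_def)
  have fin: "finite Gs" using dag_Gs finite_subset unfolding dag_def by blast
  have "?U \<subseteq> (fst ` Gs) \<times> (snd ` Gs) \<times> (fst ` Gs)" by (force simp: v_structures_def)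
  then have finU: "finite ?U" using fin by (meson finite_SigmaI finite_imageI finite_subset)
  \<comment> \<open>If some v-structure were still missing, adding it would improve the score. The
    best candidate \<open>m\<close>, possibly another one, does at least as well, so a further step
    would exist.\<close>
  have all: "add_vs G t = G" if "t \<in> ?U" for t
  proof (rule ccontr)
    assume n: "add_vs G t \<noteq> G"
    let ?g = "\<lambda>t. f (add_vs G t)"
    have "Max (?g ` ?U) \<in> ?g ` ?U" using finU that by (intro Max_in) auto
    then obtain m where m: "m \<in> ?U" "?g m = Max (?g ` ?U)" by auto
    then have "\<forall>t\<in>?U. ?g t \<le> ?g m" using finU by simp
    moreover from this have "f G < ?g m"
      using add_vs_improves[OF G(1) that n] that by (meson less_le_trans)
    moreover obtain i k j where "m = (i, k, j)" by (cases m)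
    ultimately have "\<exists>s. vs_step f ?U (K, G) s"
      using m(1) vs_step.intros[of i k j ?U G f K] v_structure_candidates[OF G(1)] by auto
    with run show False by (auto simp: runs_to_def)
  qed
  have "(i, k) \<in> G" if "(i, k, j) \<in> ?U" for i k j
    using all[OF that] by (auto simp: add_vs_def)
  with G dag_Gs show ?thesis by (intro extensionI) auto
qed

end

section \<open>From faithfulness and local consistency to the good event\<close>

lemma adjacent_not_d_separated:
  assumes "adjacent G i j" "i \<noteq> j"
  shows "\<not> d_separated G {j} {i} C"
proof -
  have "dag_path G [j, i]" using assms by (auto simp: dag_path_def adjacent_def)
  moreover have "active G C [j, i]" by (simp add: active_def)
  ultimately show ?thesis unfolding d_separated_def by fastforce
qed

text \<open>The single edge of \<open>Gs\<close> between \<open>i\<close> and \<open>j\<close> is a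
  path without interior vertices, hence active given any set. Acyclicity and
  \<open>(i, j) \<notin> G\<close> give the disjointness that faithfulness asks for.\<close>

lemma adjacent_not_cond_indep:
  assumes "faithful p S P Gs" "adjacent Gs i j" "dag p (insert (i, j) G)" "(i, j) \<notin> G"
  shows "\<not> cond_indep S P {j} {i} (parents G j)"
proof -
  have ac: "acyclic (insert (i, j) G)" using assms(3) by (simp add: dag_def)
  have "i \<noteq> j" using acyclic_irrefl[OF ac, of i] by auto
  moreover have "(j, j) \<notin> G" using acyclic_irrefl[OF ac, of j] by blast
  ultimately have "disjoint3 p {j} {i} (parents G j)"
    using assms(3,4) by (auto simp: disjoint3_def parents_def dag_def)
  then have "d_separated Gs {j} {i} (parents G j) \<longleftrightarrow> cond_indep S P {j} {i} (parents G j)"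
    using assms(1) unfolding faithful_def by blast
  with adjacent_not_d_separated[OF assms(2) \<open>i \<noteq> j\<close>] show ?thesis by simp
qed

theorem lemma1:
  fixes p :: nat
    and S :: "nat \<Rightarrow> 'a measure"
    and P :: "(nat \<Rightarrow> 'a) measure"
    and Gstar :: digraph
    and M :: "'w measure"
    and D :: "nat \<Rightarrow> 'w \<Rightarrow> (nat \<Rightarrow> 'a) list"
    and \<phi> :: "digraph \<Rightarrow> (nat \<Rightarrow> 'a) list \<Rightarrow> real"
    and G\<^sub>0 :: ugraph
    and U :: "(nat \<times> nat \<times> nat) set"
    and Ghat :: "nat \<Rightarrow> 'w \<Rightarrow> digraph"
  assumes "prob_space P" and "sets P = sets (PiM {1..p} S)"
    and "dag p Gstar" and "faithful p S P Gstar"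
    and "prob_space M" and "\<And>n. iid_samples M P n (D n)"
    and "locally_consistent p S P M D \<phi>"
    and "\<And>n \<omega>. \<omega> \<in> space M \<Longrightarrow> hgi_output \<phi> (D n \<omega>) G\<^sub>0 U (Ghat n \<omega>)"
    and "G\<^sub>0 = skeleton Gstar" and "U = v_structures Gstar"
  shows "whp M (\<lambda>n \<omega>. markov_equivalent p (Ghat n \<omega>) Gstar)"
proof -
  \<comment> \<open>All insertions whose improvement the run may rely on. There are finitely many,
    since the graphs live on \<open>{1..p}\<close>, so the improvements hold simultaneously with
    probability tending to one.\<close>
  define I where "I = {(G, i, j). dag p (insert (i, j) G) \<and> (i, j) \<notin> G \<and> adjacent Gstar i j}"
  have "I \<subseteq> Pow ({1..p} \<times> {1..p}) \<times> {1..p} \<times> {1..p}" by (auto simp: I_def dag_def)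
  then have "finite I" by (rule finite_subset) simp
  moreover have "whp M (\<lambda>n \<omega>. case t of (G, i, j) \<Rightarrow> \<phi> (insert (i, j) G) (D n \<omega>) > \<phi> G (D n \<omega>))"
    if "t \<in> I" for t
  proof -
    obtain G i j where t: "t = (G, i, j)" by (cases t)
    with that have G: "dag p (insert (i, j) G)" "(i, j) \<notin> G" "adjacent Gstar i j"
      by (auto simp: I_def)
    then have "dag p G" using acyclic_subset unfolding dag_def by blast
    with G adjacent_not_cond_indep[OF assms(4) G(3,1,2)] assms(7) t show ?thesis
      by (simp add: locally_consistent_def)
  qed
  ultimately have "whp M (\<lambda>n \<omega>. \<forall>t\<in>I. case t of (G, i, j) \<Rightarrow>
      \<phi> (insert (i, j) G) (D n \<omega>) > \<phi> G (D n \<omega>))"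
    by (rule whp_finite_all[OF assms(5)])
  then show ?thesis
  proof (rule whp_mono)
    fix n \<omega>
    assume "\<omega> \<in> space M" and better: "\<forall>t\<in>I. case t of (G, i, j) \<Rightarrow>
      \<phi> (insert (i, j) G) (D n \<omega>) > \<phi> G (D n \<omega>)"
    interpret hgi_run p Gstar "\<lambda>H. \<phi> H (D n \<omega>)"
      \<comment> \<open>On the good event the claim holds for every run, so the way ties are broken
        may depend arbitrarily on the sample.\<close>
      using assms(3) better by unfold_locales (auto simp: I_def)
    obtain s K where s:
      "runs_to (vs_step (\<lambda>H. \<phi> H (D n \<omega>)) (v_structures Gstar)) (PDGraph {} (skeleton Gstar), {}) s"
      "runs_to (main_step (\<lambda>H. \<phi> H (D n \<omega>))) s (K, Ghat n \<omega>)"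
      using assms(8)[OF \<open>\<omega> \<in> space M\<close>] unfolding assms(9,10) hgi_output_def by blast
    obtain K\<^sub>1 G\<^sub>1 where "s = (K\<^sub>1, G\<^sub>1)" by (cases s)
    with s show "markov_equivalent p (Ghat n \<omega>) Gstar" using vs_phase main_phase by blast
  qed
qed

end
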